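(* Let $P_0,P_1,P_2$ be three totally-real planes in $\mathbb{C}^2$ containing $0$, with $P_0\cap P_j=\{(0,0)\}$ for $j=1,2$. Let $g$ be a $\mathbb{C}$-linear isomorphism of $\mathbb{C}^2$ and $A_1,A_2\in\mathbb{R}^{2\times2}$ such that $g(P_0)=\mathbb{R}^2$ and $g(P_j)=(A_j+i\mathbb{I})\mathbb{R}^2$, $j=1,2$. Suppose that each of the pairwise unions $P_0\cup P_1$, $P_0\cup P_2$, $P_1\cup P_2$ is locally polynomially convex at $0\in\mathbb{C}^2$. Then $P_0\cup P_1\cup P_2$ is locally polynomially convex at $0$ if either (i) $\det[A_1,A_2]>0$ and $\det A_j>0$ for $j=1,2$; or (ii) $\det[A_1,A_2]<0$ and $\det A_j<0$ for $j=1,2$.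
   Context: A real 2-dimensional subspace $P\subset\mathbb{C}^2$ is totally real if $P\cap iP=\{0\}$. A closed set $E\subset\mathbb{C}^n$ is locally polynomially convex at $p\in E$ if $E\cap\overline{\mathbb{B}(p;r)}$ is polynomially convex (equal to its hull with respect to holomorphic polynomials) for some $r>0$. $[A,B]=AB-BA$. *)

theory Defs
  imports "HOL-Analysis.Analysis"
begin

text \<open>We model \<open>\<complex>\<^sup>2\<close> as \<open>complex \<times> complex\<close>, regarded as a real Euclidean space.\<close>

type_synonym c2 = "complex \<times> complex"

definition cscale :: "complex \<Rightarrow> c2 \<Rightarrow> c2" where
  "cscale c v = (c * fst v, c * snd v)"

definition real_plane :: "c2 set \<Rightarrow> bool" where
  "real_plane P \<longleftrightarrow> subspace P \<and> dim P = 2"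

definition totally_real :: "c2 set \<Rightarrow> bool" where
  "totally_real P \<longleftrightarrow> P \<inter> cscale \<i> ` P = {0}"

definition hpoly :: "(c2 \<Rightarrow> complex) set" where
  "hpoly = {p. \<exists>S c. finite S \<and>
     (\<forall>z. p z = (\<Sum>(a,b)\<in>S. c (a,b) * fst z ^ a * snd z ^ b))}"

definition poly_hull :: "c2 set \<Rightarrow> c2 set" where
  "poly_hull K = {z. \<forall>p\<in>hpoly. norm (p z) \<le> (SUP w\<in>K. norm (p w))}"

definition poly_convex :: "c2 set \<Rightarrow> bool" where
  "poly_convex K \<longleftrightarrow> poly_hull K = K"

definition loc_poly_convex_at :: "c2 set \<Rightarrow> c2 \<Rightarrow> bool" where
  "loc_poly_convex_at E p \<longleftrightarrow> (\<exists>r>0. poly_convex (E \<inter> cball p r))"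

text \<open>\<open>\<real>\<^sup>2\<close> inside \<open>\<complex>\<^sup>2\<close>, and \<open>(A + i I) \<real>\<^sup>2\<close> for a real 2x2 matrix A.\<close>
definition R2 :: "c2 set" where
  "R2 = {(complex_of_real a, complex_of_real b) | a b. True}"

definition graph_plane :: "real^2^2 \<Rightarrow> c2 set" where
  "graph_plane A = {(Complex ((A *v x) $ 1) (x $ 1), Complex ((A *v x) $ 2) (x $ 2)) | x. True}"

definition commutator :: "real^2^2 \<Rightarrow> real^2^2 \<Rightarrow> real^2^2" where
  "commutator A B = A ** B - B ** A"

definition clinear_iso :: "(c2 \<Rightarrow> c2) \<Rightarrow> bool" where
  "clinear_iso g \<longleftrightarrow> (\<forall>u v. g (u + v) = g u + g v) \<and>
     (\<forall>c v. g (cscale c v) = cscale c (g v)) \<and> bij g"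

end

theory Submission
  imports Defs
begin

text \<open>
  Put \<open>S = J [A\<^sub>1, A\<^sub>2]\<close>, where \<open>J\<close> is the rotation by a right angle. Then \<open>S\<close>, \<open>S A\<^sub>1\<close> and
  \<open>S A\<^sub>2\<close> are symmetric and \<open>det (S A\<^sub>j) = det [A\<^sub>1, A\<^sub>2] * det A\<^sub>j > 0\<close>. Hence the quadratic form
  \<open>w\<^sup>T S w\<close> is real on \<open>\<real>\<^sup>2\<close>, and its imaginary part \<open>2 x\<^sup>T S A\<^sub>j x\<close> on \<open>(A\<^sub>j + \<i> I) x\<close> is definite.
  If the two signs agree, the form separates \<open>P\<^sub>0\<close> from \<open>P\<^sub>1 \<union> P\<^sub>2\<close>; otherwise, up to sign, it
  separates \<open>P\<^sub>0 \<union> P\<^sub>1\<close> from \<open>P\<^sub>2\<close>. In both cases one image lies in the closed upper half-plane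
  and the other in a closed sector inside the open lower half-plane with its vertex \<open>0\<close> added, so
  Kallin's lemma applies: its zero fibre is a compact subset of the totally real plane \<open>P\<^sub>0\<close>.
  For this pair of regions Kallin's lemma is proved directly, by approximating
  the function equal to \<open>w\<^sup>3\<close> on the sector and to \<open>0\<close> on the half-plane uniformly by polynomials.
\<close>

section \<open>Polynomials and hulls\<close>

lemma hpoly_iff:
  "p \<in> hpoly \<longleftrightarrow> (\<exists>S c. finite S \<and> (\<forall>z. p z = (\<Sum>x\<in>S. c x * (fst z ^ fst x * snd z ^ snd x))))"
  by (simp add: hpoly_def case_prod_unfold mult.assoc)

lemma hpoly_const: "(\<lambda>z. k) \<in> hpoly"
  unfolding hpoly_iff by (rule exI[of _ "{(0,0)}"], rule exI[of _ "\<lambda>_. k"]) simp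

lemma hpoly_fst: "fst \<in> hpoly"
  unfolding hpoly_iff by (rule exI[of _ "{(1,0)}"], rule exI[of _ "\<lambda>_. 1"]) simp

lemma hpoly_snd: "snd \<in> hpoly"
  unfolding hpoly_iff by (rule exI[of _ "{(0,1)}"], rule exI[of _ "\<lambda>_. 1"]) simp

lemma hpoly_add:
  assumes "p \<in> hpoly" "q \<in> hpoly"
  shows "(\<lambda>z. p z + q z) \<in> hpoly"
proof -
  obtain S c where S: "finite S" "\<And>z. p z = (\<Sum>x\<in>S. c x * (fst z ^ fst x * snd z ^ snd x))"
    using assms(1) unfolding hpoly_iff by blast
  obtain T d where T: "finite T" "\<And>z. q z = (\<Sum>x\<in>T. d x * (fst z ^ fst x * snd z ^ snd x))"
    using assms(2) unfolding hpoly_iff by blast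
  let ?e = "\<lambda>x. (if x \<in> S then c x else 0) + (if x \<in> T then d x else 0)"
  have "p z + q z = (\<Sum>x\<in>S \<union> T. ?e x * (fst z ^ fst x * snd z ^ snd x))" for z
  proof -
    have "p z = (\<Sum>x\<in>S \<union> T. (if x \<in> S then c x else 0) * (fst z ^ fst x * snd z ^ snd x))"
      unfolding S(2) by (rule sum.mono_neutral_cong_left) (use S(1) T(1) in auto)
    moreover have "q z = (\<Sum>x\<in>S \<union> T. (if x \<in> T then d x else 0) * (fst z ^ fst x * snd z ^ snd x))"
      unfolding T(2) by (rule sum.mono_neutral_cong_left) (use S(1) T(1) in auto)
    ultimately show ?thesis
      by (simp only: sum.distrib[symmetric] distrib_right)
  qed
  then show ?thesis
    unfolding hpoly_iff using S(1) T(1) by (intro exI[of _ "S \<union> T"] exI[of _ ?e]) simp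
qed

lemma hpoly_sum:
  assumes "\<And>i. i \<in> I \<Longrightarrow> p i \<in> hpoly"
  shows "(\<lambda>z. \<Sum>i\<in>I. p i z) \<in> hpoly"
  using assms by (induction I rule: infinite_finite_induct) (auto simp: hpoly_const hpoly_add)

lemma hpoly_monomial_mult:
  assumes "p \<in> hpoly"
  shows "(\<lambda>z. k * (fst z ^ m * snd z ^ n) * p z) \<in> hpoly"
proof -
  obtain S c where S: "finite S" "\<And>z. p z = (\<Sum>x\<in>S. c x * (fst z ^ fst x * snd z ^ snd x))"
    using assms unfolding hpoly_iff by blast
  define h where "h = (\<lambda>x::nat \<times> nat. (fst x + m, snd x + n))"
  \<comment> \<open>Truncated subtraction undoes the shift \<open>h\<close>, and \<open>e\<close> is
    only ever evaluated on the image of \<open>S\<close> under \<open>h\<close>.\<close>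
  define e where "e = (\<lambda>x::nat \<times> nat. k * c (fst x - m, snd x - n))"
  have inj: "inj_on h S"
    by (auto simp: h_def inj_on_def prod_eq_iff)
  have "k * (fst z ^ m * snd z ^ n) * p z = (\<Sum>x\<in>h ` S. e x * (fst z ^ fst x * snd z ^ snd x))" for z
    unfolding S(2) sum.reindex[OF inj] sum_distrib_left
    by (rule sum.cong) (auto simp: h_def e_def power_add)
  then show ?thesis
    unfolding hpoly_iff using S(1) by (intro exI[of _ "h ` S"] exI[of _ e]) simp
qed

lemma hpoly_mult:
  assumes "p \<in> hpoly" "q \<in> hpoly"
  shows "(\<lambda>z. p z * q z) \<in> hpoly"
proof -
  obtain S c where S: "\<And>z. p z = (\<Sum>x\<in>S. c x * (fst z ^ fst x * snd z ^ snd x))"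
    using assms(1) unfolding hpoly_iff by blast
  show ?thesis
    unfolding S sum_distrib_right by (intro hpoly_sum hpoly_monomial_mult assms(2))
qed

lemma hpoly_diff:
  assumes "p \<in> hpoly" "q \<in> hpoly"
  shows "(\<lambda>z. p z - q z) \<in> hpoly"
  using hpoly_add[OF assms(1) hpoly_mult[OF hpoly_const[of "-1"] assms(2)]] by simp

lemma hpoly_power: "p \<in> hpoly \<Longrightarrow> (\<lambda>z. p z ^ n) \<in> hpoly"
  by (induction n) (auto simp: hpoly_const hpoly_mult)

lemmas hpoly_intros = hpoly_const hpoly_fst hpoly_snd hpoly_add hpoly_diff hpoly_mult hpoly_power

lemma continuous_on_hpoly:
  assumes "p \<in> hpoly"
  shows "continuous_on K p"
proof -
  obtain S c where S: "\<And>z. p z = (\<Sum>x\<in>S. c x * (fst z ^ fst x * snd z ^ snd x))"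
    using assms unfolding hpoly_iff by blast
  show ?thesis
    unfolding S by (intro continuous_intros)
qed

lemma hpoly_bounded:
  assumes "p \<in> hpoly" "compact K"
  obtains B where "0 < B" "\<And>z. z \<in> K \<Longrightarrow> norm (p z) \<le> B"
proof -
  have "bounded (p ` K)"
    using assms by (intro compact_imp_bounded compact_continuous_image continuous_on_hpoly)
  then show ?thesis
    using that unfolding bounded_pos by blast
qed

lemma poly_hull_le:
  assumes "z \<in> poly_hull K" "K \<noteq> {}" "p \<in> hpoly" "\<And>w. w \<in> K \<Longrightarrow> norm (p w) \<le> B"
  shows "norm (p z) \<le> B"
proof -
  have "norm (p z) \<le> (SUP w\<in>K. norm (p w))"
    using assms(1,3) unfolding poly_hull_def by blast
  also have "\<dots> \<le> B"
    using assms(2,4) by (intro cSUP_least) auto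
  finally show ?thesis .
qed

lemma norm_le_SUP:
  assumes "compact K" "p \<in> hpoly" "w \<in> K"
  shows "norm (p w) \<le> (SUP w\<in>K. norm (p w))"
proof (rule cSUP_upper[OF assms(3)])
  obtain B where "\<And>z. z \<in> K \<Longrightarrow> norm (p z) \<le> B"
    using hpoly_bounded[OF assms(2,1)] by blast
  then show "bdd_above ((\<lambda>w. norm (p w)) ` K)"
    by (intro bdd_aboveI2)
qed

lemma subset_poly_hull: "compact K \<Longrightarrow> K \<subseteq> poly_hull K"
  unfolding poly_hull_def using norm_le_SUP by blast

lemma poly_hull_le_attained:
  assumes "z \<in> poly_hull K" "compact K" "K \<noteq> {}" "p \<in> hpoly"
  obtains w where "w \<in> K" "norm (p z) \<le> norm (p w)"
proof -
  have "continuous_on K (\<lambda>w. norm (p w))"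
    by (intro continuous_on_norm continuous_on_hpoly assms)
  then obtain w where "w \<in> K" "\<And>v. v \<in> K \<Longrightarrow> norm (p v) \<le> norm (p w)"
    using continuous_attains_sup[OF assms(2,3)] by blast
  then show ?thesis
    using that poly_hull_le[OF assms(1,3,4)] by blast
qed

text \<open>Scaling a separating polynomial to the value 1 at the outside point makes its powers
  stay 1 there while they tend to 0 uniformly on \<open>K\<close>.\<close>

lemma poly_convex_separating:
  assumes "poly_convex K" "compact K" "K \<noteq> {}" "z \<notin> K"
  obtains f \<delta> where "f \<in> hpoly" "f z = 1" "0 \<le> \<delta>" "\<delta> < 1" "\<And>w. w \<in> K \<Longrightarrow> norm (f w) \<le> \<delta>"
proof -
  have "z \<notin> poly_hull K"
    using assms(1,4) by (simp add: poly_convex_def)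
  then obtain p where p: "p \<in> hpoly" "(SUP w\<in>K. norm (p w)) < norm (p z)"
    unfolding poly_hull_def by force
  define s where "s = (SUP w\<in>K. norm (p w))"
  have le: "norm (p w) \<le> s" if "w \<in> K" for w
    unfolding s_def using norm_le_SUP[OF assms(2) p(1) that] .
  obtain w0 where "w0 \<in> K"
    using assms(3) by blast
  then have s: "0 \<le> s" "s < norm (p z)"
    using le[of w0] p(2) norm_ge_zero[of "p w0"] by (simp_all add: s_def del: norm_ge_zero)
  show ?thesis
  proof (rule that[of "\<lambda>w. inverse (p z) * p w" "s / norm (p z)"])
    show "(\<lambda>w. inverse (p z) * p w) \<in> hpoly"
      by (intro hpoly_intros p)
    have "0 < norm (p z)"
      using s by linarith
    then show "inverse (p z) * p z = 1" "0 \<le> s / norm (p z)" "s / norm (p z) < 1"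
      using s by auto
    show "norm (inverse (p z) * p w) \<le> s / norm (p z)" if "w \<in> K" for w
      using divide_right_mono[OF le[OF that] norm_ge_zero[of "p z"]] by (simp add: norm_mult norm_inverse divide_inverse mult.commute)
  qed
qed

section \<open>Uniform polynomial approximation\<close>

text \<open>Membership of the restriction of \<open>h\<close> to \<open>K\<close> in the uniform
  algebra P(K); values of \<open>h\<close> off \<open>K\<close> do not matter.\<close>

definition poly_approx :: "c2 set \<Rightarrow> (c2 \<Rightarrow> complex) \<Rightarrow> bool" where
  "poly_approx K h \<longleftrightarrow> (\<forall>e>0. \<exists>p\<in>hpoly. \<forall>z\<in>K. norm (h z - p z) < e)"

lemma poly_approx_hpoly: "p \<in> hpoly \<Longrightarrow> poly_approx K p"
  unfolding poly_approx_def by force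

lemma poly_approx_cong: "(\<And>z. z \<in> K \<Longrightarrow> h z = h' z) \<Longrightarrow> poly_approx K h \<longleftrightarrow> poly_approx K h'"
  unfolding poly_approx_def by simp

lemma poly_approx_limit:
  assumes "\<And>e. e > 0 \<Longrightarrow> \<exists>h'. poly_approx K h' \<and> (\<forall>z\<in>K. norm (h z - h' z) \<le> e)"
  shows "poly_approx K h"
  unfolding poly_approx_def
proof (intro allI impI)
  fix e :: real assume "e > 0"
  then obtain h' where h': "poly_approx K h'" "\<And>z. z \<in> K \<Longrightarrow> norm (h z - h' z) \<le> e / 2"
    using assms[of "e / 2"] by auto
  then obtain p where p: "p \<in> hpoly" "\<And>z. z \<in> K \<Longrightarrow> norm (h' z - p z) < e / 2"
    using \<open>e > 0\<close> unfolding poly_approx_def by (meson half_gt_zero)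
  have "norm (h z - p z) < e" if "z \<in> K" for z
    using norm_triangle_ineq[of "h z - h' z" "h' z - p z"] h'(2)[OF that] p(2)[OF that] by simp
  then show "\<exists>p\<in>hpoly. \<forall>z\<in>K. norm (h z - p z) < e"
    using p(1) by blast
qed

lemma poly_approx_bounded:
  assumes "poly_approx K h" "compact K"
  obtains B where "0 < B" "\<And>z. z \<in> K \<Longrightarrow> norm (h z) \<le> B"
proof -
  obtain p where p: "p \<in> hpoly" "\<And>z. z \<in> K \<Longrightarrow> norm (h z - p z) < 1"
    using assms(1) unfolding poly_approx_def by (meson zero_less_one)
  obtain B where B: "0 < B" "\<And>z. z \<in> K \<Longrightarrow> norm (p z) \<le> B"
    using hpoly_bounded[OF p(1) assms(2)] by blast
  have "norm (h z) \<le> B + 1" if "z \<in> K" for z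
    using norm_triangle_ineq[of "h z - p z" "p z"] p(2)[OF that] B(2)[OF that] by simp
  then show ?thesis
    using that[of "B + 1"] B(1) by simp
qed

lemma poly_approx_add:
  assumes "poly_approx K f" "poly_approx K g"
  shows "poly_approx K (\<lambda>z. f z + g z)"
  unfolding poly_approx_def
proof (intro allI impI)
  fix e :: real assume "e > 0"
  then obtain p q where p: "p \<in> hpoly" "\<And>z. z \<in> K \<Longrightarrow> norm (f z - p z) < e / 2"
    and q: "q \<in> hpoly" "\<And>z. z \<in> K \<Longrightarrow> norm (g z - q z) < e / 2"
    using assms unfolding poly_approx_def by (meson half_gt_zero)
  have "norm (f z + g z - (p z + q z)) < e" if "z \<in> K" for z
    using norm_triangle_ineq[of "f z - p z" "g z - q z"] p(2)[OF that] q(2)[OF that]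
    by (simp add: algebra_simps)
  then show "\<exists>p\<in>hpoly. \<forall>z\<in>K. norm (f z + g z - p z) < e"
    using hpoly_add[OF p(1) q(1)] by (intro bexI[of _ "\<lambda>z. p z + q z"]) auto
qed

lemma poly_approx_mult:
  assumes "poly_approx K f" "poly_approx K g" "compact K"
  shows "poly_approx K (\<lambda>z. f z * g z)"
  unfolding poly_approx_def
proof (intro allI impI)
  fix e :: real assume e: "e > 0"
  obtain B where B: "0 < B" "\<And>z. z \<in> K \<Longrightarrow> norm (f z) \<le> B"
    using poly_approx_bounded[OF assms(1,3)] by blast
  obtain q where q: "q \<in> hpoly" "\<And>z. z \<in> K \<Longrightarrow> norm (g z - q z) < e / (2 * B)"
    using assms(2) e B(1) unfolding poly_approx_def by (metis zero_less_divide_iff zero_less_mult_iff zero_less_numeral)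
  obtain C where C: "0 < C" "\<And>z. z \<in> K \<Longrightarrow> norm (q z) \<le> C"
    using hpoly_bounded[OF q(1) assms(3)] by blast
  obtain p where p: "p \<in> hpoly" "\<And>z. z \<in> K \<Longrightarrow> norm (f z - p z) < e / (2 * C)"
    using assms(1) e C(1) unfolding poly_approx_def by (metis zero_less_divide_iff zero_less_mult_iff zero_less_numeral)
  have "norm (f z * g z - p z * q z) < e" if z: "z \<in> K" for z
  proof -
    have "norm (f z * g z - p z * q z) = norm (f z * (g z - q z) + (f z - p z) * q z)"
      by (simp add: algebra_simps)
    also have "\<dots> \<le> norm (f z) * norm (g z - q z) + norm (f z - p z) * norm (q z)"
      by (metis norm_mult norm_triangle_ineq)
    also have "\<dots> \<le> B * norm (g z - q z) + norm (f z - p z) * C"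
      using B C z by (intro add_mono mult_mono) (auto intro: less_imp_le)
    also have "\<dots> < B * (e / (2 * B)) + e / (2 * C) * C"
      using q(2)[OF z] p(2)[OF z] B(1) C(1)
      by (intro add_strict_mono mult_strict_left_mono mult_strict_right_mono)
    finally show ?thesis
      using B(1) C(1) by simp
  qed
  then show "\<exists>p\<in>hpoly. \<forall>z\<in>K. norm (f z * g z - p z) < e"
    using hpoly_mult[OF p(1) q(1)] by (intro bexI[of _ "\<lambda>z. p z * q z"]) auto
qed

lemma poly_approx_power:
  "poly_approx K f \<Longrightarrow> compact K \<Longrightarrow> poly_approx K (\<lambda>z. f z ^ n)"
  by (induction n) (simp add: poly_approx_hpoly hpoly_const, simp add: poly_approx_mult)

lemma poly_approx_cmult:
  "poly_approx K f \<Longrightarrow> compact K \<Longrightarrow> poly_approx K (\<lambda>z. k * f z)"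
  by (rule poly_approx_mult[OF poly_approx_hpoly[OF hpoly_const]])

lemma poly_approx_diff:
  assumes "poly_approx K f" "poly_approx K g" "compact K"
  shows "poly_approx K (\<lambda>z. f z - g z)"
  using poly_approx_add[OF assms(1) poly_approx_cmult[OF assms(2,3), of "-1"]] by simp

lemma poly_approx_sum:
  "(\<And>i. i \<in> I \<Longrightarrow> poly_approx K (f i)) \<Longrightarrow> poly_approx K (\<lambda>z. \<Sum>i\<in>I. f i z)"
  by (induction I rule: infinite_finite_induct)
     (auto intro: poly_approx_add poly_approx_hpoly hpoly_const)

section \<open>Geometric series and moving poles\<close>

lemma poly_approx_geometric:
  assumes "poly_approx K x" "compact K" "\<rho> < 1" "\<And>z. z \<in> K \<Longrightarrow> norm (x z) \<le> \<rho>"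
  shows "poly_approx K (\<lambda>z. 1 / (1 - x z))"
proof (cases "K = {}")
  case True
  then show ?thesis
    using hpoly_const by (auto simp: poly_approx_def)
next
  case False
  then have "0 \<le> \<rho>"
    using assms(4) norm_ge_zero order_trans by blast
  show ?thesis
  proof (rule poly_approx_limit)
    fix e :: real assume "e > 0"
    then obtain n where n: "\<rho> ^ n < e * (1 - \<rho>)"
      using real_arch_pow_inv[of "e * (1 - \<rho>)" \<rho>] assms(3) by auto
    have "norm (1 / (1 - x z) - (\<Sum>k<n. x z ^ k)) \<le> e" if z: "z \<in> K" for z
    proof -
      have lt: "norm (x z) \<le> \<rho>" "x z \<noteq> 1"
        using assms(3) assms(4)[OF z] by auto
      have ge: "1 - \<rho> \<le> norm (1 - x z)"
        using norm_triangle_ineq2[of 1 "x z"] lt by simp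
      have "1 / (1 - x z) - (\<Sum>k<n. x z ^ k) = x z ^ n / (1 - x z)"
        using lt(2) by (simp add: sum_gp_strict diff_divide_distrib)
      then have "norm (1 / (1 - x z) - (\<Sum>k<n. x z ^ k)) = norm (x z) ^ n / norm (1 - x z)"
        by (simp add: norm_divide norm_power)
      also have "\<dots> \<le> \<rho> ^ n / (1 - \<rho>)"
        using lt ge assms(3) \<open>0 \<le> \<rho>\<close> by (intro frac_le power_mono) auto
      also have "\<dots> \<le> e"
        using n assms(3) by (simp add: field_simps)
      finally show ?thesis .
    qed
    then show "\<exists>h'. poly_approx K h' \<and> (\<forall>z\<in>K. norm (1 / (1 - x z) - h' z) \<le> e)"
      using assms(1,2)
      by (intro exI[of _ "\<lambda>z. \<Sum>k<n. x z ^ k"]) (auto intro: poly_approx_sum poly_approx_power)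
  qed
qed

text \<open>Expansion about the old pole: 1/(q - t) is 1/(q - s) times a geometric series in (t -
  s)/(q - s), whose modulus on \<open>K\<close> is at most |t - s|/d < 1.\<close>

lemma poly_approx_pole_step:
  assumes "poly_approx K (\<lambda>z. 1 / (q z - s))" "compact K" "norm (t - s) < d"
    and "\<And>z. z \<in> K \<Longrightarrow> d \<le> norm (q z - s)"
  shows "poly_approx K (\<lambda>z. 1 / (q z - t))"
proof -
  have d: "0 < d"
    using assms(3) norm_ge_zero le_less_trans by blast
  have "norm ((t - s) * (1 / (q z - s))) \<le> norm (t - s) / d" if "z \<in> K" for z
    using assms(4)[OF that] d by (simp add: norm_mult norm_divide frac_le)
  then have "poly_approx K (\<lambda>z. 1 / (1 - (t - s) * (1 / (q z - s))))"
    using assms d by (intro poly_approx_geometric[of _ _ "norm (t - s) / d"] poly_approx_cmult) auto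
  then have "poly_approx K (\<lambda>z. (1 / (q z - s)) * (1 / (1 - (t - s) * (1 / (q z - s)))))"
    by (intro poly_approx_mult assms)
  moreover have "(1 / (q z - s)) * (1 / (1 - (t - s) * (1 / (q z - s)))) = 1 / (q z - t)"
    if "z \<in> K" for z
  proof -
    have "q z \<noteq> s"
      using assms(4)[OF that] d by auto
    then show ?thesis
      by (simp add: field_simps)
  qed
  ultimately show ?thesis
    by (simp cong: poly_approx_cong)
qed

text \<open>Outside a disc containing q(K) the expansion in powers of q/t converges uniformly. This
  supplies the starting point for pushing poles inward.\<close>

lemma poly_approx_pole_far:
  assumes "q \<in> hpoly" "compact K" "R < norm t" "0 \<le> R" "\<And>z. z \<in> K \<Longrightarrow> norm (q z) \<le> R"
  shows "poly_approx K (\<lambda>z. 1 / (q z - t))"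
proof -
  have t: "t \<noteq> 0"
    using assms by auto
  have "poly_approx K (\<lambda>z. 1 / (1 - (1 / t) * q z))"
    using assms t
    by (intro poly_approx_geometric[of _ _ "R / norm t"] poly_approx_cmult poly_approx_hpoly)
       (auto simp: norm_divide divide_right_mono)
  then have "poly_approx K (\<lambda>z. (- 1 / t) * (1 / (1 - (1 / t) * q z)))"
    using assms(2) by (intro poly_approx_cmult)
  moreover have "(- 1 / t) * (1 / (1 - (1 / t) * q z)) = 1 / (q z - t)" if "z \<in> K" for z
  proof -
    have "q z \<noteq> t"
      using assms(3) assms(5)[OF that] by auto
    then show ?thesis
      using t by (simp add: field_simps)
  qed
  ultimately show ?thesis
    by (simp cong: poly_approx_cong)
qed

text \<open>Runge's pole pushing, radially to infinity.\<close>

lemma poly_approx_pole_ray: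
  assumes "q \<in> hpoly" "compact K" "t \<noteq> 0"
    and ray: "\<And>l z. 1 \<le> l \<Longrightarrow> z \<in> K \<Longrightarrow> q z \<noteq> l *\<^sub>R t"
  shows "poly_approx K (\<lambda>z. 1 / (q z - t))"
proof -
  obtain R where R: "0 < R" "\<And>z. z \<in> K \<Longrightarrow> norm (q z) \<le> R"
    using hpoly_bounded[OF assms(1,2)] by blast
  \<comment> \<open>The multiplier is chosen so that the pole \<open>L *\<^sub>R t\<close> lies
    outside the disc of radius \<open>R\<close>; the maximum with 1 puts the original pole on the
    segment.\<close>
  define L where "L = max 1 ((R + 1) / norm t)"
  have L: "1 \<le> L" "R < norm (L *\<^sub>R t)"
  proof -
    have "(R + 1) / norm t * norm t \<le> L * norm t"
      by (intro mult_right_mono) (auto simp: L_def)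
    then show "1 \<le> L" "R < norm (L *\<^sub>R t)"
      using assms(3) by (auto simp: L_def)
  qed
  have "compact ((\<lambda>l. l *\<^sub>R t) ` {1..L})"
    by (intro compact_continuous_image continuous_intros) auto
  moreover have "closed (q ` K)"
    by (intro compact_imp_closed compact_continuous_image continuous_on_hpoly assms)
  moreover have "(\<lambda>l. l *\<^sub>R t) ` {1..L} \<inter> q ` K = {}"
    using ray by force
  ultimately obtain d where d: "0 < d"
    "\<And>x y. x \<in> (\<lambda>l. l *\<^sub>R t) ` {1..L} \<Longrightarrow> y \<in> q ` K \<Longrightarrow> d \<le> dist x y"
    using separate_compact_closed by metis
  have dist: "d \<le> norm (q z - l *\<^sub>R t)" if "1 \<le> l" "l \<le> L" "z \<in> K" for l z
    using d(2)[OF imageI imageI, of l z] that by (simp add: dist_norm norm_minus_commute)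
  \<comment> \<open>A step of length \<open>\<eta>\<close> in the multiplier moves the pole by d/2,
    which is less than the distance of the segment from q(K).\<close>
  define \<eta> where "\<eta> = d / (2 * norm t)"
  have \<eta>: "0 < \<eta>" "\<eta> * norm t < d"
    using d(1) assms(3) by (auto simp: \<eta>_def)
  \<comment> \<open>Induction on the number of steps taken inward from \<open>L\<close>:
    \<open>k\<close> steps reach every multiplier within \<open>k * \<eta>\<close> of
    \<open>L\<close>.\<close>
  have push: "poly_approx K (\<lambda>z. 1 / (q z - l *\<^sub>R t))"
    if "1 \<le> l" "l \<le> L" "L - real k * \<eta> \<le> l" for l k
    using that
  proof (induction k arbitrary: l)
    case 0
    then have "l = L"
      by simp
    then show ?case
      using poly_approx_pole_far[OF assms(1,2) L(2)] R by simp
  next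
    case (Suc k)
    define m where "m = min L (l + \<eta>)"
    have m: "1 \<le> m" "m \<le> L" "L - real k * \<eta> \<le> m" "0 \<le> m - l" "m - l \<le> \<eta>"
      using Suc.prems \<eta>(1) L(1) by (auto simp: m_def min_def algebra_simps)
    have "norm (l *\<^sub>R t - m *\<^sub>R t) = (m - l) * norm t"
      using m(4) by (simp add: scaleR_diff_left[symmetric])
    also have "\<dots> \<le> \<eta> * norm t"
      using m(5) by (intro mult_right_mono) auto
    finally have "norm (l *\<^sub>R t - m *\<^sub>R t) < d"
      using \<eta>(2) by simp
    then show ?case
      using poly_approx_pole_step[OF Suc.IH[OF m(1-3)] assms(2)] dist[OF m(1,2)] by blast
  qed
  obtain k where "L - 1 < real k * \<eta>"
    using reals_Archimedean3[OF \<eta>(1)] by blast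
  then show ?thesis
    using push[of 1 k] L(1) by simp
qed

section \<open>Poles in the gap between half-plane and cone, and the cutoff function\<close>

definition sector_region :: "real \<Rightarrow> real \<Rightarrow> complex set" where
  "sector_region c R = {w. norm w \<le> R \<and> (0 \<le> Im w \<or> Im w \<le> - c * norm w)}"

text \<open>The ray from \<open>t\<close> to infinity avoids the region: the gap between the upper
  half-plane and the cone \<open>Im w \<le> - c * norm w\<close> is invariant under dilations, and
  the exterior of the disc under dilations by factors at least 1.\<close>

lemma poly_approx_pole_gap:
  assumes "q \<in> hpoly" "compact K" "q ` K \<subseteq> sector_region c R"
    and t: "Im t < 0" "- c * norm t < Im t \<or> R < norm t"
  shows "poly_approx K (\<lambda>z. 1 / (q z - t))"
proof (rule poly_approx_pole_ray[OF assms(1,2)])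
  show "t \<noteq> 0"
    using t(1) by auto
  fix l :: real and z assume l: "1 \<le> l" and z: "z \<in> K"
  have "l *\<^sub>R t \<notin> sector_region c R"
  proof
    assume "l *\<^sub>R t \<in> sector_region c R"
    then have *: "l * norm t \<le> R" "0 \<le> l * Im t \<or> l * Im t \<le> l * (- c * norm t)"
      using l by (auto simp: sector_region_def algebra_simps)
    have "norm t \<le> l * norm t"
      using l mult_right_mono[of 1 l "norm t"] by simp
    then have "norm t \<le> R"
      using *(1) by simp
    moreover have "l * Im t < 0"
      using l t(1) by (simp add: mult_pos_neg)
    ultimately have "l * Im t \<le> l * (- c * norm t)" "- c * norm t < Im t"
      using * t(2) by auto
    then show False
      using l mult_strict_left_mono[of "- c * norm t" "Im t" l] by linarith
  qed
  then show "q z \<noteq> l *\<^sub>R t"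
    using assms(3) z by auto
qed

text \<open>The pole \<open>t\<close> satisfies \<open>\<bar>1 - \<i> a t\<bar> = 1\<close>, a circle tangent to the real axis at \<open>0\<close>
  which inside the disc of radius \<open>R\<close> stays in the gap between the two parts of the region.\<close>

lemma poly_approx_inverse_unit_shift:
  assumes "q \<in> hpoly" "compact K" "q ` K \<subseteq> sector_region c R"
    and a: "0 < a" "a * R \<le> c" "0 < c" and \<eta>: "norm \<eta> = 1" "\<eta> \<noteq> 1"
  shows "poly_approx K (\<lambda>z. 1 / ((1 - \<i> * of_real a * q z) - \<eta>))"
proof -
  \<comment> \<open>The solution of 1 - i a t = \<open>\<eta>\<close>.\<close>
  define t where "t = \<i> * (\<eta> - 1) / of_real a"
  have n1: "(Re \<eta>)\<^sup>2 + (Im \<eta>)\<^sup>2 = 1"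
    using \<eta>(1) by (metis cmod_power2 one_power2)
  have "Re \<eta> \<noteq> 1"
    using n1 \<eta>(2) by (auto simp: complex_eq_iff)
  moreover have "Re \<eta> \<le> 1"
    using complex_Re_le_cmod[of \<eta>] \<eta>(1) by simp
  ultimately have re: "Re \<eta> < 1"
    by simp
  have imt: "Im t = (Re \<eta> - 1) / a"
    by (simp add: t_def)
  have "(norm t)\<^sup>2 = (norm (\<eta> - 1))\<^sup>2 / a\<^sup>2"
    using a(1) by (simp add: t_def norm_divide norm_mult power_divide)
  also have "(norm (\<eta> - 1))\<^sup>2 = 2 * (1 - Re \<eta>)"
    unfolding cmod_power2 using n1 by (simp add: power2_eq_square algebra_simps)
  \<comment> \<open>The circle equation in the form a |t|^2 = -2 Im t. For |t| at most R it gives a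
    |t| < 2c, and hence -Im t < c |t|, which is the gap condition.\<close>
  finally have nt: "a * (norm t)\<^sup>2 = - 2 * Im t"
    using a(1) by (simp add: imt power2_eq_square field_simps)
  have t0: "Im t < 0"
    using re a(1) by (simp add: imt divide_neg_pos)
  have "- c * norm t < Im t" if "norm t \<le> R"
  proof -
    have pos: "0 < norm t"
      using t0 by auto
    have "a * norm t \<le> a * R"
      using that a(1) by simp
    then have "a * norm t < 2 * c"
      using a by linarith
    then have "a * norm t * norm t < 2 * c * norm t"
      using pos by simp
    then show ?thesis
      using nt by (simp add: power2_eq_square)
  qed
  then have "- c * norm t < Im t \<or> R < norm t"
    by fastforce
  then have "poly_approx K (\<lambda>z. (\<i> / of_real a) * (1 / (q z - t)))"
    by (intro poly_approx_cmult poly_approx_pole_gap[OF assms(1-3) t0] assms(2))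
  moreover have "(\<i> / of_real a) * (1 / (q z - t)) = 1 / ((1 - \<i> * of_real a * q z) - \<eta>)" for z
  proof -
    have "(1 - \<i> * of_real a * q z) - \<eta> = - \<i> * of_real a * (q z - t)"
      using a(1) by (simp add: t_def field_simps)
    then show ?thesis
      by (simp add: divide_inverse)
  qed
  ultimately show ?thesis
    by simp
qed

text \<open>Exponents that are powers of two allow induction by a difference of squares: with s a
  square root of \<open>\<eta>\<close>, the denominator splits into factors with constants s and -s.
  Both are again unimodular and differ from 1, because their square does.\<close>

lemma poly_approx_inverse_power_shift:
  assumes "q \<in> hpoly" "compact K" "q ` K \<subseteq> sector_region c R"
    and a: "0 < a" "a * R \<le> c" "0 < c" and "norm \<eta> = 1" "\<eta> \<noteq> 1"
  shows "poly_approx K (\<lambda>z. 1 / ((1 - \<i> * of_real a * q z) ^ (2 ^ k) - \<eta>))"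
  using assms(7,8)
proof (induction k arbitrary: \<eta>)
  case 0
  then show ?case
    using poly_approx_inverse_unit_shift[OF assms(1-6)] by simp
next
  case (Suc k)
  define s where "s = csqrt \<eta>"
  have s2: "s\<^sup>2 = \<eta>"
    by (simp add: s_def)
  have "(norm s)\<^sup>2 = 1\<^sup>2"
    using Suc.prems(1) by (simp add: s2 flip: norm_power)
  then have s: "norm s = 1"
    by (rule power2_eq_imp_eq) auto
  have s1: "s \<noteq> 1" "- s \<noteq> 1"
    using s2 Suc.prems(2) by (auto simp: minus_equation_iff[of s])
  have "poly_approx K (\<lambda>z. (1 / ((1 - \<i> * of_real a * q z) ^ (2 ^ k) - s)) *
      (1 / ((1 - \<i> * of_real a * q z) ^ (2 ^ k) - (- s))))"
    using s s1 by (intro poly_approx_mult Suc.IH assms(2)) auto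
  moreover have "(1 / (u ^ (2 ^ k) - s)) * (1 / (u ^ (2 ^ k) - (- s))) = 1 / (u ^ (2 ^ Suc k) - \<eta>)" for u
  proof -
    have "u ^ (2 ^ Suc k) = (u ^ (2 ^ k))\<^sup>2"
      by (simp only: power_mult[symmetric] power_Suc2)
    then have "(u ^ (2 ^ k) - s) * (u ^ (2 ^ k) - (- s)) = u ^ (2 ^ Suc k) - \<eta>"
      unfolding s2[symmetric] by (simp add: algebra_simps power2_eq_square)
    then show ?thesis
      by (simp only: times_divide_times_eq mult_1)
  qed
  ultimately show ?case
    by simp
qed

text \<open>With \<open>u = 1 - \<i> a w\<close> and \<open>s = a\<^sup>2 \<bar>w\<bar>\<^sup>2\<close> one has \<open>\<bar>u\<bar>\<^sup>2 \<ge> 1 + s\<close> on the upper and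
  \<open>\<bar>u\<bar>\<^sup>2 \<le> 1 - s\<close> on the lower part, so \<open>w\<^sup>3 / (1 + u ^ (2 M))\<close> converges uniformly to
  \<open>0\<close> and \<open>w\<^sup>3\<close>, respectively, at rate \<open>\<bar>w\<bar> / (M a\<^sup>2)\<close>.\<close>

lemma sector_cutoff_error:
  assumes "w \<in> sector_region c R" "0 < a" "a * R \<le> c" "0 < M"
  defines "u \<equiv> 1 - \<i> * of_real a * w"
  shows "norm ((if 0 \<le> Im w then 0 else w ^ 3) - w ^ 3 * (1 / (u ^ (2 * M) - (-1)))) \<le> R / (real M * a\<^sup>2)"
proof (cases "w = 0")
  case True
  then show ?thesis
    using assms by (auto simp: sector_region_def)
next
  case False
  define s where "s = a\<^sup>2 * (norm w)\<^sup>2"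
  have s: "0 < s"
    using False assms(2) by (simp add: s_def)
  have wR: "norm w \<le> R"
    using assms(1) by (simp add: sector_region_def)
  have u2: "(norm u)\<^sup>2 = 1 + 2 * a * Im w + s"
    unfolding u_def s_def cmod_power2 by (simp add: power2_eq_square algebra_simps)
  have bern: "1 + real M * s \<le> (1 + s) ^ M"
    using Bernoulli_inequality[of s M] s by simp
  have nu: "norm (u ^ (2 * M)) = ((norm u)\<^sup>2) ^ M"
    by (simp add: norm_power power_mult)
  have Ms: "0 < real M * s"
    using s assms(4) by simp
  \<comment> \<open>Dividing the cube by s = a^2 |w|^2 leaves a single factor |w|, which is at most
    R.\<close>
  have fin: "norm w ^ 3 / (real M * s) \<le> R / (real M * a\<^sup>2)"
  proof -
    have "norm w ^ 3 / (real M * s) = norm w / (real M * a\<^sup>2)"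
      using False by (simp add: s_def power2_eq_square power3_eq_cube)
    then show ?thesis
      using wR assms(2) by (simp add: divide_right_mono)
  qed
  show ?thesis
  proof (cases "0 \<le> Im w")
    case True
    then have "1 + s \<le> (norm u)\<^sup>2"
      using assms(2) by (simp add: u2)
    then have "(1 + s) ^ M \<le> norm (u ^ (2 * M))"
      unfolding nu using s by (intro power_mono) auto
    then have "real M * s \<le> norm (u ^ (2 * M) - (-1))"
      using bern norm_triangle_ineq2[of "u ^ (2 * M)" "-1"] by simp
    then have "norm w ^ 3 / norm (u ^ (2 * M) - (-1)) \<le> norm w ^ 3 / (real M * s)"
      using Ms by (intro frac_le) auto
    then show ?thesis
      using fin True by (simp add: norm_mult norm_divide norm_power)
  next
    case im: False
    then have "Im w \<le> - c * norm w"
      using assms(1) by (auto simp: sector_region_def)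
    \<comment> \<open>This is where \<open>a * R \<le> c\<close> enters: a |w|^2 is at most c |w|,
      hence at most -Im w, so the term 2 a Im w outweighs s twice and |u|^2 drops to at most 1 -
      s.\<close>
    moreover have "a * norm w \<le> c"
      using wR assms(2,3) by (meson less_eq_real_def mult_left_mono order_trans)
    then have "a * norm w * norm w \<le> c * norm w"
      by (intro mult_right_mono) auto
    ultimately have "a * (Im w + a * norm w * norm w) \<le> 0"
      using assms(2) by (intro mult_nonneg_nonpos) auto
    then have "(norm u)\<^sup>2 \<le> 1 - s"
      unfolding u2 by (simp add: s_def power2_eq_square algebra_simps)
    define y where "y = norm (u ^ (2 * M))"
    have y0: "0 \<le> y"
      by (simp add: y_def)
    have "y \<le> (1 - s) ^ M"
      unfolding y_def nu using \<open>(norm u)\<^sup>2 \<le> 1 - s\<close> by (intro power_mono) auto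
    moreover have "0 \<le> 1 - s"
      using \<open>(norm u)\<^sup>2 \<le> 1 - s\<close> zero_le_power2 order_trans by blast
    \<comment> \<open>The product (1 - s)(1 + s) is at most 1, so the Bernoulli lower bound for (1 +
      s)^M becomes an upper bound for y.\<close>
    ultimately have "y * (1 + s) ^ M \<le> ((1 - s) * (1 + s)) ^ M"
      using s by (simp add: power_mult_distrib mult_right_mono)
    also have "\<dots> \<le> 1"
      using s \<open>0 \<le> 1 - s\<close> by (intro power_le_one) (simp_all add: algebra_simps mult_le_one)
    finally have "y * (1 + real M * s) \<le> 1"
      using mult_left_mono[OF bern y0] by linarith
    then have ys: "y * (real M * s) \<le> 1 - y"
      by (simp add: algebra_simps)
    have "y < 1"
    proof (rule ccontr)
      assume "\<not> y < 1"
      then have "0 < y * (real M * s)"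
        using Ms by simp
      then show False
        using ys \<open>\<not> y < 1\<close> by simp
    qed
    have D: "1 - y \<le> norm (u ^ (2 * M) - (-1))"
      using norm_triangle_ineq2[of "-1" "u ^ (2 * M)"] norm_minus_commute[of "-1" "u ^ (2 * M)"]
      by (simp add: y_def)
    then have nz: "u ^ (2 * M) - (-1) \<noteq> 0"
      using \<open>y < 1\<close> by auto
    have "w ^ 3 - w ^ 3 * (1 / (u ^ (2 * M) - (-1))) = w ^ 3 * (u ^ (2 * M) / (u ^ (2 * M) - (-1)))"
      using nz by (simp add: field_simps)
    then have "norm (w ^ 3 - w ^ 3 * (1 / (u ^ (2 * M) - (-1)))) = norm w ^ 3 * (y / norm (u ^ (2 * M) - (-1)))"
      by (simp add: norm_mult norm_divide norm_power y_def)
    also have "\<dots> \<le> norm w ^ 3 * (1 / (real M * s))"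
    proof (rule mult_left_mono)
      have "y / norm (u ^ (2 * M) - (-1)) \<le> y / (1 - y)"
        using D \<open>y < 1\<close> y0 by (intro frac_le) auto
      also have "\<dots> \<le> 1 / (real M * s)"
        using ys Ms \<open>y < 1\<close> by (simp add: field_simps)
      finally show "y / norm (u ^ (2 * M) - (-1)) \<le> 1 / (real M * s)" .
    qed simp
    finally show ?thesis
      using fin im by simp
  qed
qed

lemma poly_approx_sector_cutoff:
  assumes "q \<in> hpoly" "compact K" "q ` K \<subseteq> sector_region c R" "0 < c" "0 < R"
  shows "poly_approx K (\<lambda>z. if 0 \<le> Im (q z) then 0 else q z ^ 3)"
proof (rule poly_approx_limit)
  fix e :: real assume e: "e > 0"
  \<comment> \<open>The largest \<open>a\<close> allowed by \<open>a * R \<le> c\<close>. The cutoff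
    uses M = 2^k and the root-free constant -1 in place of \<open>\<eta>\<close>.\<close>
  define a where "a = c / R"
  have a: "0 < a" "a * R \<le> c"
    using assms by (auto simp: a_def)
  obtain k where "R / (e * a\<^sup>2) < 2 ^ k"
    using real_arch_pow[of 2] by auto
  then have k: "R / (real (2 ^ k) * a\<^sup>2) \<le> e"
    using e a by (simp add: field_simps)
  let ?h = "\<lambda>z. q z ^ 3 * (1 / ((1 - \<i> * of_real a * q z) ^ (2 ^ Suc k) - (-1)))"
  have "poly_approx K ?h"
    using assms(1,2) a
    by (intro poly_approx_mult poly_approx_hpoly hpoly_power
        poly_approx_inverse_power_shift[OF assms(1-3) a assms(4)]) auto
  moreover have "norm ((if 0 \<le> Im (q z) then 0 else q z ^ 3) - ?h z) \<le> e" if "z \<in> K" for z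
    using sector_cutoff_error[of "q z" c R a "2 ^ k"] assms(3) that a k by auto
  ultimately show "\<exists>h'. poly_approx K h' \<and>
      (\<forall>z\<in>K. norm ((if 0 \<le> Im (q z) then 0 else q z ^ 3) - h' z) \<le> e)"
    by blast
qed

section \<open>Kallin's lemma for a half-plane and a sector\<close>

text \<open>The hull inequality survives uniform limits, provided that the approximation also holds
  at the hull point; hence \<open>insert z X\<close>.\<close>

lemma poly_hull_approx_le:
  assumes "z \<in> poly_hull X" "X \<noteq> {}" "poly_approx (insert z X) h" "\<And>w. w \<in> X \<Longrightarrow> norm (h w) \<le> B"
  shows "norm (h z) \<le> B"
proof (rule field_le_epsilon)
  fix e :: real assume e: "e > 0"
  then obtain p where p: "p \<in> hpoly" "\<And>w. w \<in> insert z X \<Longrightarrow> norm (h w - p w) < e / 2"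
    using assms(3) unfolding poly_approx_def by (meson half_gt_zero)
  have "norm (p w) \<le> B + e / 2" if "w \<in> X" for w
    using norm_triangle_ineq2[of "p w" "h w"] p(2)[of w] assms(4)[OF that] that
    by (simp add: norm_minus_commute)
  then have "norm (p z) \<le> B + e / 2"
    using poly_hull_le[OF assms(1,2) p(1)] by blast
  then show "norm (h z) \<le> B + e"
    using norm_triangle_ineq2[of "h z" "p z"] p(2)[of z] by simp
qed

text \<open>Let f be 1 at z and at most \<open>\<delta>\<close> < 1 on \<open>Y\<close>. Since h
  vanishes on the rest of \<open>X\<close>, the product f^n h is at most \<open>\<delta>\<close>^n B
  on all of \<open>X\<close>, yet equals h(z) at z for every n.\<close>

lemma poly_hull_vanishing:
  assumes "z \<in> poly_hull X" "compact X" "poly_approx (insert z X) h"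
    and Y: "poly_convex Y" "compact Y" "Y \<noteq> {}" "Y \<subseteq> X" "z \<notin> Y"
    and zero: "\<And>w. w \<in> X - Y \<Longrightarrow> h w = 0"
  shows "h z = 0"
proof -
  obtain f \<delta> where f: "f \<in> hpoly" "f z = 1" "0 \<le> \<delta>" "\<delta> < 1" "\<And>w. w \<in> Y \<Longrightarrow> norm (f w) \<le> \<delta>"
    using poly_convex_separating[OF Y(1,2,3,5)] by blast
  have K: "compact (insert z X)"
    using assms(2) by simp
  obtain B where B: "0 < B" "\<And>w. w \<in> insert z X \<Longrightarrow> norm (h w) \<le> B"
    using poly_approx_bounded[OF assms(3) K] by blast
  have "norm (h z) \<le> \<delta> ^ n * B" for n
  proof -
    have "poly_approx (insert z X) (\<lambda>w. f w ^ n * h w)"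
      using f(1) by (intro poly_approx_mult poly_approx_hpoly hpoly_power assms(3) K)
    moreover have "norm (f w ^ n * h w) \<le> \<delta> ^ n * B" if "w \<in> X" for w
    proof (cases "w \<in> Y")
      case True
      then show ?thesis
        unfolding norm_mult norm_power using f(3,5) B that by (intro mult_mono power_mono) auto
    next
      case False
      then show ?thesis
        using zero that f(3) B(1) by simp
    qed
    moreover have "X \<noteq> {}"
      using Y(3,4) by blast
    ultimately have "norm (f z ^ n * h z) \<le> \<delta> ^ n * B"
      using poly_hull_approx_le[OF assms(1)] by blast
    then show ?thesis
      by (simp add: f(2))
  qed
  moreover have "(\<lambda>n. \<delta> ^ n * B) \<longlonglongrightarrow> 0"
    using f(3,4) by (intro tendsto_mult_left_zero LIMSEQ_realpow_zero)
  ultimately have "norm (h z) \<le> 0"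
    by (intro LIMSEQ_le_const) auto
  then show ?thesis
    by simp
qed

text \<open>The chosen point lies on a fixed ray in the gap, so its distance from the region is
  proportional to \<open>s\<close>. The two entries of the minimum come from the half-plane and from
  the cone.\<close>

lemma sector_region_gap_dist:
  assumes "w \<in> sector_region c R" "0 < c" "0 < s"
  shows "min (c / 2) (c / (2 * (1 + c))) * s \<le> norm (w - Complex s (- (c / 2) * s))"
proof -
  define d where "d = norm (w - Complex s (- (c / 2) * s))"
  have im: "\<bar>Im w + c / 2 * s\<bar> \<le> d" and re: "\<bar>Re w - s\<bar> \<le> d"
    using abs_Im_le_cmod[of "w - Complex s (- (c / 2) * s)"]
      abs_Re_le_cmod[of "w - Complex s (- (c / 2) * s)"] by (auto simp: d_def)
  consider "0 \<le> Im w" | "Im w \<le> - c * norm w"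
    using assms(1) by (auto simp: sector_region_def)
  then have "c / 2 * s \<le> d \<or> c / (2 * (1 + c)) * s \<le> d"
  proof cases
    case 1
    then show ?thesis
      using im by auto
  next
    case 2
    have "s - d \<le> norm w"
      using re abs_Re_le_cmod[of w] by linarith
    then have "c * (s - d) \<le> c * norm w"
      using assms(2) by simp
    then have "c * s \<le> 2 * (1 + c) * d"
      using 2 im by (simp add: algebra_simps)
    then show ?thesis
      using assms(2) by (simp add: field_simps)
  qed
  then show ?thesis
    unfolding d_def[symmetric] using assms(3)
    by (meson min.cobounded1 min.cobounded2 mult_right_mono less_imp_le order_trans)
qed

lemma compact_hpoly_zeros:
  assumes "compact X" "q \<in> hpoly"
  shows "compact {w \<in> X. q w = 0}"
proof -
  have "closed {w \<in> X. q w = 0}"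
    using continuous_closed_preimage_constant[OF continuous_on_hpoly compact_imp_closed] assms by blast
  then have "compact (X \<inter> {w \<in> X. q w = 0})"
    by (rule compact_Int_closed[OF assms(1)])
  then show ?thesis
    by (simp add: Int_absorb1)
qed

text \<open>At a zero of \<open>q\<close> the functions \<open>t / (t - q)\<close>, with \<open>t \<rightarrow> 0\<close> inside the gap, are
  uniformly bounded, equal to \<open>1\<close>, and tend to \<open>0\<close> away from the zero set.\<close>

lemma poly_hull_zero_fibre:
  assumes "z \<in> poly_hull X" "compact X" "q \<in> hpoly" "q z = 0"
    and sector: "q ` insert z X \<subseteq> sector_region c R" and "0 < c"
    and Z: "poly_convex {w \<in> X. q w = 0}" "{w \<in> X. q w = 0} \<noteq> {}"
  shows "z \<in> X"
proof (rule ccontr)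
  assume "z \<notin> X"
  have K: "compact (insert z X)"
    using assms(2) by simp
  have "z \<notin> {w \<in> X. q w = 0}"
    using \<open>z \<notin> X\<close> by simp
  then obtain f \<delta> where f: "f \<in> hpoly" "f z = 1" "0 \<le> \<delta>" "\<delta> < 1"
    and small: "\<And>w. w \<in> {w \<in> X. q w = 0} \<Longrightarrow> norm (f w) \<le> \<delta>"
    using poly_convex_separating[OF Z(1) compact_hpoly_zeros[OF assms(2,3)] Z(2)] by blast
  \<comment> \<open>A threshold strictly between \<open>\<delta>\<close> and 1. Below it f^n is
    small; the part of \<open>X\<close> where f reaches it is compact and free of zeros of q, so |q|
    has a positive lower bound \<open>\<rho>\<close> there.\<close>
  define \<delta>' where "\<delta>' = (1 + \<delta>) / 2"
  have \<delta>': "\<delta> < \<delta>'" "0 \<le> \<delta>'" "\<delta>' < 1"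
    using f by (auto simp: \<delta>'_def)
  obtain \<rho> where \<rho>: "0 < \<rho>" "\<And>w. w \<in> X \<Longrightarrow> \<delta>' \<le> norm (f w) \<Longrightarrow> \<rho> \<le> norm (q w)"
  proof -
    define C where "C = X \<inter> (\<lambda>w. norm (f w)) -` {\<delta>'..}"
    have "closed C"
      unfolding C_def by (intro continuous_closed_preimage continuous_on_norm continuous_on_hpoly f(1)
          compact_imp_closed assms(2) closed_atLeast)
    then have "compact (X \<inter> C)"
      by (rule compact_Int_closed[OF assms(2)])
    then have C: "compact C"
      by (simp add: C_def flip: Int_assoc)
    show ?thesis
    proof (cases "C = {}")
      case True
      then show ?thesis
        using that[of 1] by (auto simp: C_def)
    next
      case False
      obtain v where v: "v \<in> C" "\<And>w. w \<in> C \<Longrightarrow> norm (q v) \<le> norm (q w)"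
        using continuous_attains_inf[OF C False, of "\<lambda>w. norm (q w)"]
          continuous_on_norm[OF continuous_on_hpoly[OF assms(3)]] by blast
      have "q v \<noteq> 0"
        using v(1) small[of v] \<delta>'(1) by (auto simp: C_def)
      then show ?thesis
        using that[of "norm (q v)"] v(2) by (auto simp: C_def)
    qed
  qed
  obtain B where B: "0 < B" "\<And>w. w \<in> X \<Longrightarrow> norm (f w) \<le> B"
    using hpoly_bounded[OF f(1) assms(2)] by blast
  define k where "k = min (c / 2) (c / (2 * (1 + c)))"
  have k: "0 < k"
    using assms(6) by (simp add: k_def)
  \<comment> \<open>A bound for |t|/|q - t| on \<open>X\<close> that does not depend on how close t
    is to 0.\<close>
  define C where "C = (1 + c / 2) / k"
  have C: "0 < C"
    using k assms(6) by (simp add: C_def)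
  obtain n where n: "\<delta>' ^ n < 1 / (2 * C)"
    using real_arch_pow_inv[of "1 / (2 * C)" \<delta>'] \<delta>' C by auto
  \<comment> \<open>Chosen after \<open>n\<close>, so small that |t|(2 B^n + 1) is at most
    \<open>\<rho>\<close>; where |q| is at least \<open>\<rho>\<close> this makes |t|/|q - t| at
    most 1/(2 B^n), compensating the growth of f^n.\<close>
  define s where "s = \<rho> / ((1 + c / 2) * (2 * B ^ n + 1))"
  have s: "0 < s"
    using \<rho>(1) B(1) assms(6) by (auto simp: s_def intro!: divide_pos_pos mult_pos_pos add_nonneg_pos)
  define t where "t = Complex s (- (c / 2) * s)"
  have t: "s \<le> norm t" "norm t \<le> (1 + c / 2) * s" "Im t < 0" "t \<noteq> 0"
  proof -
    show "s \<le> norm t"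
      using complex_Re_le_cmod[of t] by (simp add: t_def)
    show "norm t \<le> (1 + c / 2) * s"
      using cmod_le[of t] s assms(6) by (simp add: t_def abs_mult algebra_simps)
    show "Im t < 0" "t \<noteq> 0"
      using s assms(6) by (auto simp: t_def complex_eq_iff)
  qed
  have "c * s \<le> c * norm t"
    using t(1) assms(6) by simp
  moreover have "0 < c * s"
    using s assms(6) by simp
  ultimately have gap: "- c * norm t < Im t"
    by (simp add: t_def)
  \<comment> \<open>The product f^n t/(t - q), equal to 1 at z; on \<open>X\<close> one of the two
    factors is always small enough to push it down to 1/2.\<close>
  define h where "h = (\<lambda>w. f w ^ n * (- t * (1 / (q w - t))))"
  have "poly_approx (insert z X) h"
    unfolding h_def using gap t(3)
    by (intro poly_approx_mult poly_approx_cmult poly_approx_hpoly hpoly_power f(1) K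
        poly_approx_pole_gap[OF assms(3) K sector]) auto
  moreover have "norm (h w) \<le> 1 / 2" if w: "w \<in> X" for w
  proof (cases "\<delta>' \<le> norm (f w)")
    case False
    have "k * s \<le> norm (q w - t)"
      unfolding t_def k_def using sector w assms(6) s
      by (intro sector_region_gap_dist[of _ c R]) auto
    then have "norm t / norm (q w - t) \<le> ((1 + c / 2) * s) / (k * s)"
      using t(2) k s assms(6) by (intro frac_le) auto
    then have "norm t / norm (q w - t) \<le> C"
      using s by (simp add: C_def)
    moreover have "norm (f w) ^ n \<le> \<delta>' ^ n"
      using False by (intro power_mono) auto
    ultimately have "norm (h w) \<le> \<delta>' ^ n * C"
      unfolding h_def norm_mult norm_power using \<delta>'
      by (intro mult_mono) (auto simp: norm_divide)
    also have "\<dots> \<le> 1 / 2"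
      using n C by (simp add: field_simps)
    finally show ?thesis .
  next
    case True
    then have "\<rho> \<le> norm (q w)"
      using \<rho>(2) w by blast
    have Bn: "0 < B ^ n"
      using B(1) by simp
    have "(1 + c / 2) * s * (2 * B ^ n + 1) = \<rho>"
      using assms(6) Bn by (simp add: s_def)
    then have "norm t * (2 * B ^ n + 1) \<le> \<rho>"
      using mult_right_mono[OF t(2), of "2 * B ^ n + 1"] Bn by simp
    then have "2 * B ^ n * norm t \<le> norm (q w - t)"
      using norm_triangle_ineq2[of "q w" t] \<open>\<rho> \<le> norm (q w)\<close> by (simp add: algebra_simps)
    moreover have "0 < 2 * B ^ n * norm t"
      using Bn t(4) by simp
    ultimately have "norm t / norm (q w - t) \<le> norm t / (2 * B ^ n * norm t)"
      by (intro frac_le) auto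
    then have "norm t / norm (q w - t) \<le> 1 / (2 * B ^ n)"
      using t(4) by simp
    moreover have "norm (f w) ^ n \<le> B ^ n"
      using B(2)[OF w] by (intro power_mono) auto
    ultimately have "norm (h w) \<le> B ^ n * (1 / (2 * B ^ n))"
      unfolding h_def norm_mult norm_power using Bn
      by (intro mult_mono) (auto simp: norm_divide)
    then show ?thesis
      using B(1) by simp
  qed
  moreover have "X \<noteq> {}"
    using Z(2) by blast
  ultimately have "norm (h z) \<le> 1 / 2"
    using poly_hull_approx_le[OF assms(1)] by blast
  then show False
    using t(4) by (simp add: h_def f(2) assms(4))
qed

text \<open>A hull point z outside the union first has its q-value in the region. The cutoff h
  vanishes off \<open>X2\<close> and q^3 - h vanishes off \<open>X1\<close>, so both vanish at z by
  convexity of the pieces. Hence q(z) = 0, and the zero fibre decides.\<close>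

theorem poly_convex_union_sector:
  assumes X1: "compact X1" "poly_convex X1" "X1 \<noteq> {}" "\<And>z. z \<in> X1 \<Longrightarrow> 0 \<le> Im (q z)"
    and X2: "compact X2" "poly_convex X2" "X2 \<noteq> {}" "\<And>z. z \<in> X2 \<Longrightarrow> Im (q z) \<le> - c * norm (q z)"
    and "q \<in> hpoly" "0 < c"
    and Z: "poly_convex {z \<in> X1 \<union> X2. q z = 0}" "{z \<in> X1 \<union> X2. q z = 0} \<noteq> {}"
  shows "poly_convex (X1 \<union> X2)"
proof -
  define X where "X = X1 \<union> X2"
  have X: "compact X" "X \<noteq> {}"
    using X1 X2 by (auto simp: X_def)
  obtain R where R: "0 < R" "\<And>z. z \<in> X \<Longrightarrow> norm (q z) \<le> R"
    using hpoly_bounded[OF assms(9) X(1)] by blast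
  have qX: "q ` X \<subseteq> sector_region c R"
    using R X1(4) X2(4) by (auto simp: sector_region_def X_def)
  have "z \<in> X" if z: "z \<in> poly_hull X" for z
  proof (rule ccontr)
    assume nz: "z \<notin> X"
    have "q z \<in> sector_region c R"
    proof (rule ccontr)
      \<comment> \<open>If p is close to 1/(q - q(z)) on \<open>X\<close>, then 1 - (q - q(z)) p is
        at most 1/2 there but equals 1 at z.\<close>
      assume "q z \<notin> sector_region c R"
      moreover have "norm (q z) \<le> R"
        using poly_hull_le[OF z X(2) assms(9) R(2)] .
      ultimately have "poly_approx X (\<lambda>w. 1 / (q w - q z))"
        by (intro poly_approx_pole_gap[OF assms(9) X(1) qX]) (auto simp: sector_region_def)
      moreover obtain B where B: "0 < B" "\<And>w. w \<in> X \<Longrightarrow> norm (q w - q z) \<le> B"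
        using hpoly_bounded[OF hpoly_diff[OF assms(9) hpoly_const[of "q z"]] X(1)] by metis
      ultimately obtain p where p: "p \<in> hpoly" "\<And>w. w \<in> X \<Longrightarrow> norm (1 / (q w - q z) - p w) < 1 / (2 * B)"
        unfolding poly_approx_def by (metis zero_less_divide_1_iff zero_less_mult_iff zero_less_numeral)
      have "norm (1 - (q w - q z) * p w) \<le> 1 / 2" if w: "w \<in> X" for w
      proof -
        have "q w - q z \<noteq> 0"
          using qX w \<open>q z \<notin> sector_region c R\<close> by auto
        then have "1 - (q w - q z) * p w = (q w - q z) * (1 / (q w - q z) - p w)"
          by (simp add: algebra_simps)
        then have "norm (1 - (q w - q z) * p w) = norm (q w - q z) * norm (1 / (q w - q z) - p w)"
          by (simp add: norm_mult)
        also have "\<dots> \<le> B * (1 / (2 * B))"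
          using B p(2)[OF w] w by (intro mult_mono) auto
        finally show ?thesis
          using B(1) by simp
      qed
      moreover have "(\<lambda>w. 1 - (q w - q z) * p w) \<in> hpoly"
        by (intro hpoly_intros p(1) assms(9))
      ultimately have "norm (1 - (q z - q z) * p z) \<le> 1 / 2"
        using poly_hull_le[OF z X(2), of "\<lambda>w. 1 - (q w - q z) * p w"] by blast
      then show False
        by simp
    qed
    then have qK: "q ` insert z X \<subseteq> sector_region c R"
      using qX by auto
    have K: "compact (insert z X)"
      using X(1) by simp
    define h where "h = (\<lambda>w. if 0 \<le> Im (q w) then 0 else q w ^ 3)"
    have h: "poly_approx (insert z X) h"
      unfolding h_def by (rule poly_approx_sector_cutoff[OF assms(9) K qK assms(10) R(1)])
    have "h z = 0"
      using nz X1(4) X2 by (intro poly_hull_vanishing[OF z X(1) h, of X2]) (auto simp: X_def h_def)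
    moreover have "q z ^ 3 - h z = 0"
    proof (rule poly_hull_vanishing[OF z X(1), of _ X1])
      show "poly_approx (insert z X) (\<lambda>w. q w ^ 3 - h w)"
        by (intro poly_approx_diff h poly_approx_hpoly hpoly_power assms(9) K)
      fix w assume "w \<in> X - X1"
      then have "Im (q w) \<le> - c * norm (q w)"
        using X2(4)[of w] by (auto simp: X_def)
      \<comment> \<open>The cone and the closed half-plane meet only at 0, where the two branches of
        the cutoff agree.\<close>
      moreover have "q w = 0" if "0 \<le> Im (q w)"
      proof -
        have "c * norm (q w) \<le> 0"
          using calculation that by simp
        then show ?thesis
          using assms(10) by (simp add: mult_le_0_iff)
      qed
      ultimately show "q w ^ 3 - h w = 0"
        by (auto simp: h_def)
    qed (use X1 nz in \<open>auto simp: X_def\<close>)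
    ultimately have "q z = 0"
      by simp
    then have "z \<in> X"
      using poly_hull_zero_fibre[OF z X(1) assms(9) _ qK assms(10)] Z by (simp add: X_def)
    then show False
      using nz by simp
  qed
  then show ?thesis
    unfolding poly_convex_def using subset_poly_hull[OF X(1)] by (auto simp: X_def)
qed

section \<open>Totally real planes\<close>

text \<open>Take the sum of squares m of l1 - Re l1(z) and l2 - Re l2(z). On \<open>K\<close> it is
  a squared real distance in [0, B], so 1 - m/B has modulus at most 1; at z it is 1 + b/B with b the
  squared imaginary part. A point of \<open>K\<close> attaining the maximum must therefore have the
  same coordinates as z.\<close>

lemma poly_convex_real_coordinates:
  assumes "compact K" "K \<noteq> {}" and l: "l1 \<in> hpoly" "l2 \<in> hpoly"
    and real: "\<And>z. z \<in> K \<Longrightarrow> Im (l1 z) = 0" "\<And>z. z \<in> K \<Longrightarrow> Im (l2 z) = 0"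
    and inj: "\<And>z w. l1 z = l1 w \<Longrightarrow> l2 z = l2 w \<Longrightarrow> z = w"
  shows "poly_convex K"
proof -
  have "z \<in> K" if z: "z \<in> poly_hull K" for z
  proof -
    define m where "m = (\<lambda>w. (l1 w - of_real (Re (l1 z))) ^ 2 + (l2 w - of_real (Re (l2 z))) ^ 2)"
    define r where "r = (\<lambda>w. (Re (l1 w) - Re (l1 z))\<^sup>2 + (Re (l2 w) - Re (l2 z))\<^sup>2)"
    define b where "b = (Im (l1 z))\<^sup>2 + (Im (l2 z))\<^sup>2"
    have m: "m \<in> hpoly"
      unfolding m_def by (intro hpoly_intros l)
    obtain B where B: "0 < B" "\<And>w. w \<in> K \<Longrightarrow> norm (m w) \<le> B"
      using hpoly_bounded[OF m assms(1)] by blast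
    have "(\<lambda>w. 1 - of_real (1 / B) * m w) \<in> hpoly"
      by (intro hpoly_intros m)
    then obtain w where w: "w \<in> K" "norm (1 - of_real (1 / B) * m z) \<le> norm (1 - of_real (1 / B) * m w)"
      using poly_hull_le_attained[OF z assms(1,2)] by blast
    have mw: "m w = of_real (r w)"
      using real w(1) by (simp add: m_def r_def complex_eq_iff power2_eq_square)
    have mz: "m z = of_real (- b)"
      by (simp add: m_def b_def complex_eq_iff power2_eq_square)
    have r0: "0 \<le> r w" and b0: "0 \<le> b"
      by (auto simp: r_def b_def)
    have "r w \<le> B"
      using B(2)[OF w(1)] r0 by (simp add: mw)
    then have "norm (1 - of_real (1 / B) * m w) = 1 - r w / B"
      using B(1) norm_of_real[of "1 - 1 / B * r w", where 'a = complex] by (simp add: mw)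
    moreover have "norm (1 - of_real (1 / B) * m z) = 1 + b / B"
      using B(1) b0 norm_of_real[of "1 - 1 / B * (- b)", where 'a = complex] by (simp add: mz)
    ultimately have "(r w + b) / B \<le> 0"
      using w(2) by (simp add: add_divide_distrib)
    then have "r w + b \<le> 0"
      using B(1) by (simp add: divide_le_0_iff)
    then have "r w = 0" "b = 0"
      using r0 b0 by auto
    then have "z = w"
      using real w(1) by (intro inj) (auto simp: r_def b_def complex_eq_iff sum_power2_eq_zero_iff)
    then show ?thesis
      using w(1) by simp
  qed
  then show ?thesis
    unfolding poly_convex_def using subset_poly_hull[OF assms(1)] by auto
qed

section \<open>Real binary quadratic forms and the commutator form\<close>

lemma pos_def_quadratic_lower_bound:
  fixes \<alpha> \<beta> \<gamma> :: real
  assumes "0 < \<alpha>" "\<beta>\<^sup>2 < \<alpha> * \<gamma>"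
  obtains \<mu> where "0 < \<mu>" "\<And>x y. \<mu> * (x\<^sup>2 + y\<^sup>2) \<le> \<alpha> * x\<^sup>2 + 2 * \<beta> * x * y + \<gamma> * y\<^sup>2"
proof -
  have "0 < \<alpha> * \<gamma>"
    using assms(2) zero_le_power2[of \<beta>] by linarith
  then have g: "0 < \<gamma>"
    using assms(1) by (simp add: zero_less_mult_iff)
  \<comment> \<open>Determinant over trace, which lies below both eigenvalues.\<close>
  define \<mu> where "\<mu> = (\<alpha> * \<gamma> - \<beta>\<^sup>2) / (\<alpha> + \<gamma>)"
  have \<mu>: "0 < \<mu>" "\<mu> * (\<alpha> + \<gamma>) = \<alpha> * \<gamma> - \<beta>\<^sup>2"
    using assms g by (auto simp: \<mu>_def)
  have "\<alpha> - \<mu> = (\<alpha>\<^sup>2 + \<beta>\<^sup>2) / (\<alpha> + \<gamma>)"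
    using assms(1) g by (simp add: \<mu>_def field_simps power2_eq_square)
  then have pos: "0 < \<alpha> - \<mu>"
    using assms(1) g by (simp add: add_pos_nonneg)
  have "\<mu> * (x\<^sup>2 + y\<^sup>2) \<le> \<alpha> * x\<^sup>2 + 2 * \<beta> * x * y + \<gamma> * y\<^sup>2" for x y
  proof -
    define F where "F = \<alpha> * x\<^sup>2 + 2 * \<beta> * x * y + \<gamma> * y\<^sup>2 - \<mu> * (x\<^sup>2 + y\<^sup>2)"
    \<comment> \<open>Completing the square; by the choice of \<open>\<mu>\<close> the remaining
      coefficient of y^2 is just \<open>\<mu>\<close>^2.\<close>
    have "(\<alpha> - \<mu>) * F = ((\<alpha> - \<mu>) * x + \<beta> * y)\<^sup>2 + (\<alpha> * \<gamma> - \<beta>\<^sup>2 - \<mu> * (\<alpha> + \<gamma>) + \<mu>\<^sup>2) * y\<^sup>2"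
      unfolding F_def by (simp add: power2_eq_square algebra_simps)
    also have "\<dots> \<ge> 0"
      using \<mu>(2) by simp
    finally have "0 \<le> F"
      using pos by (simp add: zero_le_mult_iff)
    then show ?thesis
      by (simp add: F_def)
  qed
  then show ?thesis
    using that \<mu>(1) by blast
qed

lemma definite_quadratic_lower_bound:
  fixes \<alpha> \<beta> \<gamma> :: real
  assumes "\<beta>\<^sup>2 < \<alpha> * \<gamma>"
  obtains \<sigma> \<mu> where "\<sigma> = 1 \<or> \<sigma> = - 1" "0 < \<mu>"
    "\<And>x y. \<mu> * (x\<^sup>2 + y\<^sup>2) \<le> \<sigma> * (\<alpha> * x\<^sup>2 + 2 * \<beta> * x * y + \<gamma> * y\<^sup>2)"
proof -
  have "\<alpha> \<noteq> 0"
    using assms zero_le_power2[of \<beta>] by auto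
  then consider "0 < \<alpha>" | "0 < - \<alpha>"
    by linarith
  then show ?thesis
  proof cases
    case 1
    then show ?thesis
      using pos_def_quadratic_lower_bound[OF 1 assms] that[of 1] by (metis mult_1)
  next
    case 2
    obtain \<mu> where "0 < \<mu>" "\<And>x y. \<mu> * (x\<^sup>2 + y\<^sup>2) \<le> - \<alpha> * x\<^sup>2 + 2 * (- \<beta>) * x * y + - \<gamma> * y\<^sup>2"
      using pos_def_quadratic_lower_bound[OF 2, of "- \<beta>" "- \<gamma>"] assms by auto
    then show ?thesis
      using that[of "- 1" \<mu>] by simp
  qed
qed

lemma quadratic_upper_bound:
  fixes a b c x y :: real
  shows "\<bar>a * x\<^sup>2 + 2 * b * x * y + c * y\<^sup>2\<bar> \<le> (\<bar>a\<bar> + \<bar>b\<bar> + \<bar>c\<bar>) * (x\<^sup>2 + y\<^sup>2)"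
proof -
  have "\<bar>2 * x * y\<bar> \<le> x\<^sup>2 + y\<^sup>2"
    using zero_le_power2[of "x - y"] zero_le_power2[of "x + y"]
    by (simp add: power2_eq_square algebra_simps abs_le_iff)
  then have "\<bar>b\<bar> * \<bar>2 * x * y\<bar> \<le> \<bar>b\<bar> * (x\<^sup>2 + y\<^sup>2)"
    by (intro mult_left_mono) auto
  moreover have "\<bar>a * x\<^sup>2\<bar> \<le> \<bar>a\<bar> * (x\<^sup>2 + y\<^sup>2)" "\<bar>c * y\<^sup>2\<bar> \<le> \<bar>c\<bar> * (x\<^sup>2 + y\<^sup>2)"
    by (auto simp: abs_mult intro!: mult_left_mono)
  moreover have "\<bar>a * x\<^sup>2 + 2 * b * x * y + c * y\<^sup>2\<bar> \<le> \<bar>a * x\<^sup>2\<bar> + \<bar>b\<bar> * \<bar>2 * x * y\<bar> + \<bar>c * y\<^sup>2\<bar>"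
  proof -
    have "\<bar>b\<bar> * \<bar>2 * x * y\<bar> = \<bar>2 * b * x * y\<bar>"
      by (simp add: abs_mult)
    then show ?thesis
      by linarith
  qed
  ultimately show ?thesis
    by (simp add: algebra_simps)
qed

text \<open>For \<open>C\<close> of trace zero this is \<open>w\<^sup>T S w\<close> with the symmetric matrix \<open>S = J C\<close>,
  \<open>J\<close> being the rotation by a right angle.\<close>

definition rot_form :: "real^2^2 \<Rightarrow> c2 \<Rightarrow> complex" where
  "rot_form C w = of_real (C$2$1) * fst w ^ 2 + of_real (2 * C$2$2) * fst w * snd w
     - of_real (C$1$2) * snd w ^ 2"

lemma rot_form_R2: "w \<in> R2 \<Longrightarrow> Im (rot_form C w) = 0"
  by (auto simp: R2_def rot_form_def power2_eq_square)

text \<open>The third hypothesis says that \<open>S A\<close> is symmetric, so the imaginary part of the form on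
  \<open>(A + \<i> I) x\<close> is \<open>2 x\<^sup>T S A x\<close>, which is definite because \<open>det (S A) = det C * det A\<close>.\<close>

lemma rot_form_graph_plane_sector:
  assumes tr: "C$1$1 = - C$2$2" and det: "0 < det C * det A"
    and sym: "C$2$1 * A$1$2 + C$2$2 * A$2$2 = C$2$2 * A$1$1 - C$1$2 * A$2$1"
  obtains \<sigma> \<mu> where "\<sigma> = 1 \<or> \<sigma> = - 1" "0 < \<mu>"
    "\<And>w. w \<in> graph_plane A \<Longrightarrow> \<mu> * norm (rot_form C w) \<le> \<sigma> * Im (rot_form C w)"
    "\<And>w. w \<in> graph_plane A \<Longrightarrow> rot_form C w = 0 \<Longrightarrow> w = 0"
proof -
  \<comment> \<open>The entries of the symmetric matrix S A.\<close>
  define \<alpha> where "\<alpha> = C$2$1 * A$1$1 + C$2$2 * A$2$1"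
  define \<beta> where "\<beta> = C$2$1 * A$1$2 + C$2$2 * A$2$2"
  define \<gamma> where "\<gamma> = C$2$2 * A$1$2 - C$1$2 * A$2$2"
  have "\<alpha> * \<gamma> - \<beta>\<^sup>2 = \<alpha> * \<gamma> - \<beta> * (C$2$2 * A$1$1 - C$1$2 * A$2$1)"
    unfolding sym[symmetric] by (simp add: \<beta>_def power2_eq_square)
  also have "\<dots> = det C * det A"
    unfolding \<alpha>_def \<beta>_def \<gamma>_def det_2 tr by (simp add: algebra_simps)
  finally have "\<beta>\<^sup>2 < \<alpha> * \<gamma>"
    using det by simp
  then obtain \<sigma> \<mu> where \<sigma>: "\<sigma> = 1 \<or> \<sigma> = - 1" and \<mu>: "0 < \<mu>"
    and lower: "\<And>x y. \<mu> * (x\<^sup>2 + y\<^sup>2) \<le> \<sigma> * (\<alpha> * x\<^sup>2 + 2 * \<beta> * x * y + \<gamma> * y\<^sup>2)"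
    using definite_quadratic_lower_bound by blast
  \<comment> \<open>P, T, U are the entries of A^T S A - S, the matrix of the real part of the form
    on (A + i I)x; L is a crude bound for its norm.\<close>
  define P where "P = C$2$1 * ((A$1$1)\<^sup>2 - 1) + 2 * C$2$2 * A$1$1 * A$2$1 - C$1$2 * (A$2$1)\<^sup>2"
  define T where "T = C$2$1 * A$1$1 * A$1$2 + C$2$2 * (A$1$1 * A$2$2 + A$1$2 * A$2$1 - 1) - C$1$2 * A$2$1 * A$2$2"
  define U where "U = C$2$1 * (A$1$2)\<^sup>2 + 2 * C$2$2 * A$1$2 * A$2$2 - C$1$2 * ((A$2$2)\<^sup>2 - 1)"
  define L where "L = \<bar>P\<bar> + \<bar>T\<bar> + \<bar>U\<bar>"
  have im: "Im (rot_form C w) = 2 * (\<alpha> * x\<^sup>2 + 2 * \<beta> * x * y + \<gamma> * y\<^sup>2)"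
    and re: "Re (rot_form C w) = P * x\<^sup>2 + 2 * T * x * y + U * y\<^sup>2"
    if w: "w = (Complex (A$1$1 * x + A$1$2 * y) x, Complex (A$2$1 * x + A$2$2 * y) y)" for w x y
  proof -
    have "Im (rot_form C w) = 2 * (\<alpha> * x\<^sup>2 + (\<beta> + (C$2$2 * A$1$1 - C$1$2 * A$2$1)) * x * y + \<gamma> * y\<^sup>2)"
      unfolding w rot_form_def \<alpha>_def \<beta>_def \<gamma>_def by (simp add: power2_eq_square algebra_simps)
    then show "Im (rot_form C w) = 2 * (\<alpha> * x\<^sup>2 + 2 * \<beta> * x * y + \<gamma> * y\<^sup>2)"
      unfolding sym[symmetric] by (simp add: \<beta>_def)
    show "Re (rot_form C w) = P * x\<^sup>2 + 2 * T * x * y + U * y\<^sup>2"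
      unfolding w rot_form_def P_def T_def U_def by (simp add: power2_eq_square algebra_simps)
  qed
  have graph: "\<exists>x y. w = (Complex (A$1$1 * x + A$1$2 * y) x, Complex (A$2$1 * x + A$2$2 * y) y)"
    if "w \<in> graph_plane A" for w
    using that by (auto simp: graph_plane_def matrix_vector_mult_def sum_2)
  have L0: "0 \<le> L"
    by (simp add: L_def)
  have bound: "1 / (L / (2 * \<mu>) + 1) * norm (rot_form C w) \<le> \<sigma> * Im (rot_form C w)"
    if wA: "w \<in> graph_plane A" for w
  proof -
    obtain x y where w: "w = (Complex (A$1$1 * x + A$1$2 * y) x, Complex (A$2$1 * x + A$2$2 * y) y)"
      using graph[OF wA] by blast
    have low: "2 * \<mu> * (x\<^sup>2 + y\<^sup>2) \<le> \<sigma> * Im (rot_form C w)"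
      unfolding im[OF w] using mult_left_mono[OF lower[of x y], of 2] by (simp only: ac_simps)
    then have "x\<^sup>2 + y\<^sup>2 \<le> \<sigma> * Im (rot_form C w) / (2 * \<mu>)"
      using \<mu> by (simp add: field_simps)
    then have "L * (x\<^sup>2 + y\<^sup>2) \<le> L * (\<sigma> * Im (rot_form C w) / (2 * \<mu>))"
      using L0 by (intro mult_left_mono)
    moreover have "\<bar>Re (rot_form C w)\<bar> \<le> L * (x\<^sup>2 + y\<^sup>2)"
      unfolding re[OF w] L_def by (rule quadratic_upper_bound)
    moreover have "\<bar>Im (rot_form C w)\<bar> = \<sigma> * Im (rot_form C w)"
    proof -
      have "0 \<le> 2 * \<mu> * (x\<^sup>2 + y\<^sup>2)"
        using \<mu> by simp
      then have "0 \<le> \<sigma> * Im (rot_form C w)"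
        using low by linarith
      then show ?thesis
        using \<sigma> by auto
    qed
    ultimately have "norm (rot_form C w) \<le> (L / (2 * \<mu>) + 1) * (\<sigma> * Im (rot_form C w))"
      using cmod_le[of "rot_form C w"] by (simp add: algebra_simps)
    moreover have "0 < L / (2 * \<mu>) + 1"
      using L0 \<mu> by (simp add: add_nonneg_pos)
    ultimately show ?thesis
      by (simp add: pos_divide_le_eq mult.commute)
  qed
  have zero: "w = 0" if wA: "w \<in> graph_plane A" and w0: "rot_form C w = 0" for w
  proof -
    obtain x y where w: "w = (Complex (A$1$1 * x + A$1$2 * y) x, Complex (A$2$1 * x + A$2$2 * y) y)"
      using graph[OF wA] by blast
    have "\<alpha> * x\<^sup>2 + 2 * \<beta> * x * y + \<gamma> * y\<^sup>2 = 0"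
      using im[OF w] w0 by simp
    then have "\<mu> * (x\<^sup>2 + y\<^sup>2) \<le> 0"
      using lower[of x y] by simp
    then have "x\<^sup>2 + y\<^sup>2 \<le> 0"
      using \<mu> by (simp add: mult_le_0_iff)
    then have "x = 0" "y = 0"
      by (auto simp: sum_power2_le_zero_iff)
    then show ?thesis
      by (simp add: w prod_eq_iff complex_eq_iff)
  qed
  have "0 < 1 / (L / (2 * \<mu>) + 1)"
    using L0 \<mu> by (simp add: add_nonneg_pos)
  then show ?thesis
    using that[OF \<sigma> _ bound zero] by blast
qed

text \<open>For a 2x2 matrix M, J M is symmetric exactly when M has trace zero. By cyclicity of the
  trace, C, C A and C B have trace zero.\<close>

lemma commutator_symmetrizes:
  fixes A B :: "real^2^2"
  defines "C \<equiv> commutator A B"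
  shows "C$1$1 = - C$2$2"
    and "C$2$1 * A$1$2 + C$2$2 * A$2$2 = C$2$2 * A$1$1 - C$1$2 * A$2$1"
    and "C$2$1 * B$1$2 + C$2$2 * B$2$2 = C$2$2 * B$1$1 - C$1$2 * B$2$1"
  by (simp_all add: C_def commutator_def matrix_matrix_mult_def sum_2 algebra_simps)

section \<open>Linear coordinates and compact subsets of the planes\<close>

lemma clinear_iso_coordinates_hpoly:
  assumes "clinear_iso g"
  shows "(\<lambda>z. fst (g z)) \<in> hpoly" "(\<lambda>z. snd (g z)) \<in> hpoly"
proof -
  have g: "g z = cscale (fst z) (g (1, 0)) + cscale (snd z) (g (0, 1))" for z
  proof -
    have "z = cscale (fst z) (1, 0) + cscale (snd z) (0, 1)"
      by (simp add: cscale_def prod_eq_iff)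
    then show ?thesis
      using assms unfolding clinear_iso_def by metis
  qed
  have "(\<lambda>z. fst z * fst (g (1, 0)) + snd z * fst (g (0, 1))) \<in> hpoly"
    "(\<lambda>z. fst z * snd (g (1, 0)) + snd z * snd (g (0, 1))) \<in> hpoly"
    by (intro hpoly_intros)+
  then show "(\<lambda>z. fst (g z)) \<in> hpoly" "(\<lambda>z. snd (g z)) \<in> hpoly"
    by (subst g, simp add: cscale_def)+
qed

lemma clinear_iso_inj: "clinear_iso g \<Longrightarrow> g z = g w \<Longrightarrow> z = w"
  unfolding clinear_iso_def bij_def inj_def by blast

lemma clinear_iso_cscale: "clinear_iso g \<Longrightarrow> g (cscale c z) = cscale c (g z)"
  unfolding clinear_iso_def by blast

lemma clinear_iso_zero: "clinear_iso g \<Longrightarrow> g 0 = 0"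
  unfolding clinear_iso_def by (metis add_cancel_right_right add.right_neutral)

text \<open>If det(A + i I) vanished, A would have trace 0 and determinant 1, so A^2 = -I and (A + i
  I)R^2 would be invariant under multiplication by i, contrary to total reality.\<close>

lemma graph_plane_det_nonzero:
  assumes "clinear_iso g" "g ` P = graph_plane A" "totally_real P"
  shows "(of_real (A$1$1) + \<i>) * (of_real (A$2$2) + \<i>) - of_real (A$1$2 * A$2$1) \<noteq> 0"
proof
  assume 0: "(of_real (A$1$1) + \<i>) * (of_real (A$2$2) + \<i>) - of_real (A$1$2 * A$2$1) = 0"
  then have *: "A$1$1 * A$2$2 - 1 = A$1$2 * A$2$1" "A$1$1 + A$2$2 = 0"
    by (auto simp: complex_eq_iff)
  \<comment> \<open>Under the trace relation x = A y, so that (A + i I)x = i (A + i I)y.\<close>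
  define x :: "real^2" where "x = vector [- (A$2$2), A$2$1]"
  define y :: "real^2" where "y = vector [1, 0]"
  define G :: "real^2 \<Rightarrow> c2" where
    "G = (\<lambda>x. (Complex ((A *v x) $ 1) (x $ 1), Complex ((A *v x) $ 2) (x $ 2)))"
  have "G x \<in> g ` P" "G y \<in> g ` P"
    unfolding assms(2) graph_plane_def G_def by blast+
  then obtain p r where p: "p \<in> P" "g p = G x" and r: "r \<in> P" "g r = G y"
    by auto
  have "G x = cscale \<i> (G y)"
    using * by (simp add: G_def x_def y_def cscale_def complex_eq_iff matrix_vector_mult_def sum_2
        algebra_simps)
  then have "g p = g (cscale \<i> r)"
    using p r by (simp add: clinear_iso_cscale[OF assms(1)])
  then have "p = cscale \<i> r"
    by (rule clinear_iso_inj[OF assms(1)])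
  then have "p \<in> P \<inter> cscale \<i> ` P"
    using p(1) r(1) by auto
  then have "p = 0"
    using assms(3) by (auto simp: totally_real_def)
  then have "r = 0"
    using \<open>p = cscale \<i> r\<close> by (simp add: cscale_def prod_eq_iff)
  then have "G y = 0"
    using r(2) clinear_iso_zero[OF assms(1)] by simp
  then show False
    by (simp add: G_def y_def prod_eq_iff complex_eq_iff)
qed

text \<open>Inverting A + i I by Cramer's rule gives complex linear coordinates that are real on
  \<open>P\<close>.\<close>

lemma poly_convex_subset_graph_plane:
  assumes "clinear_iso g" "g ` P = graph_plane A" "totally_real P" "compact K" "K \<noteq> {}" "K \<subseteq> P"
  shows "poly_convex K"
proof -
  define a b c d :: complex where "a = of_real (A$1$1) + \<i>" and "b = of_real (A$1$2)"
    and "c = of_real (A$2$1)" and "d = of_real (A$2$2) + \<i>"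
  define D where "D = a * d - b * c"
  have D: "D \<noteq> 0"
    using graph_plane_det_nonzero[OF assms(1-3)] by (simp add: D_def a_def b_def c_def d_def)
  define l1 where "l1 = (\<lambda>z. inverse D * (d * fst (g z) - b * snd (g z)))"
  define l2 where "l2 = (\<lambda>z. inverse D * (a * snd (g z) - c * fst (g z)))"
  have inv: "fst (g z) = a * l1 z + b * l2 z" "snd (g z) = c * l1 z + d * l2 z" for z
  proof -
    have "D * (a * l1 z + b * l2 z) = D * fst (g z)" "D * (c * l1 z + d * l2 z) = D * snd (g z)"
      using D by (simp_all add: l1_def l2_def field_simps) (simp_all add: D_def algebra_simps)
    then show "fst (g z) = a * l1 z + b * l2 z" "snd (g z) = c * l1 z + d * l2 z"
      using D by auto
  qed
  have real: "Im (l1 z) = 0 \<and> Im (l2 z) = 0" if "z \<in> K" for z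
  proof -
    have "g z \<in> graph_plane A"
      using assms(2,6) that by blast
    then obtain x where "g z = (Complex ((A *v x) $ 1) (x $ 1), Complex ((A *v x) $ 2) (x $ 2))"
      by (auto simp: graph_plane_def)
    then have "fst (g z) = a * of_real (x$1) + b * of_real (x$2)"
      "snd (g z) = c * of_real (x$1) + d * of_real (x$2)"
      by (simp_all add: a_def b_def c_def d_def complex_eq_iff matrix_vector_mult_def sum_2)
    then have "l1 z = inverse D * (D * of_real (x$1))" "l2 z = inverse D * (D * of_real (x$2))"
      unfolding l1_def l2_def by (simp_all add: D_def algebra_simps)
    then show ?thesis
      using D by simp
  qed
  show ?thesis
  proof (rule poly_convex_real_coordinates[OF assms(4,5), of l1 l2])
    show "l1 \<in> hpoly" "l2 \<in> hpoly"
      unfolding l1_def l2_def by (intro hpoly_intros clinear_iso_coordinates_hpoly[OF assms(1)])+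
    show "z = w" if "l1 z = l1 w" "l2 z = l2 w" for z w
    proof -
      have "g z = g w"
        using that by (simp add: prod_eq_iff inv)
      then show ?thesis
        by (rule clinear_iso_inj[OF assms(1)])
    qed
  qed (use real in auto)
qed

lemma poly_convex_subset_R2:
  assumes "clinear_iso g" "g ` P = R2" "compact K" "K \<noteq> {}" "K \<subseteq> P"
  shows "poly_convex K"
proof (rule poly_convex_real_coordinates[OF assms(3,4) clinear_iso_coordinates_hpoly[OF assms(1)]])
  have "g z \<in> R2" if "z \<in> K" for z
    using assms(2,5) that by blast
  then show "Im (fst (g z)) = 0" "Im (snd (g z)) = 0" if "z \<in> K" for z
    using that by (fastforce simp: R2_def)+
  show "z = w" if "fst (g z) = fst (g w)" "snd (g z) = snd (g w)" for z w
    using clinear_iso_inj[OF assms(1) prod_eqI[OF that]] .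
qed

lemma compact_plane_ball: "real_plane P \<Longrightarrow> compact (P \<inter> cball 0 r)"
  unfolding real_plane_def using closed_subspace closed_Int_compact compact_cball by blast

section \<open>Separation of the three planes by the commutator form\<close>

theorem theorem1p3:
  fixes P0 P1 P2 :: "c2 set" and g :: "c2 \<Rightarrow> c2" and A1 A2 :: "real^2^2"
  assumes "real_plane P0" "real_plane P1" "real_plane P2"
    and "totally_real P0" "totally_real P1" "totally_real P2"
    and "P0 \<inter> P1 = {0}" "P0 \<inter> P2 = {0}"
    and "clinear_iso g"
    and "g ` P0 = R2" "g ` P1 = graph_plane A1" "g ` P2 = graph_plane A2"
    and "loc_poly_convex_at (P0 \<union> P1) 0"
    and "loc_poly_convex_at (P0 \<union> P2) 0"
    and "loc_poly_convex_at (P1 \<union> P2) 0"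
    and "(det (commutator A1 A2) > 0 \<and> det A1 > 0 \<and> det A2 > 0) \<or>
         (det (commutator A1 A2) < 0 \<and> det A1 < 0 \<and> det A2 < 0)"
  shows "loc_poly_convex_at (P0 \<union> P1 \<union> P2) 0"
proof -
  define C where "C = commutator A1 A2"
  \<comment> \<open>Both sign alternatives enter only through these products, the determinants of S
    A1 and S A2.\<close>
  have det: "0 < det C * det A1" "0 < det C * det A2"
    using assms(16) by (auto simp: C_def zero_less_mult_iff)
  note sym = commutator_symmetrizes[of A1 A2, folded C_def]
  obtain \<sigma>1 \<mu>1 where 1: "\<sigma>1 = 1 \<or> \<sigma>1 = - 1" "0 < \<mu>1"
    "\<And>w. w \<in> graph_plane A1 \<Longrightarrow> \<mu>1 * norm (rot_form C w) \<le> \<sigma>1 * Im (rot_form C w)"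
    "\<And>w. w \<in> graph_plane A1 \<Longrightarrow> rot_form C w = 0 \<Longrightarrow> w = 0"
    using rot_form_graph_plane_sector[OF sym(1) det(1) sym(2)] by blast
  obtain \<sigma>2 \<mu>2 where 2: "\<sigma>2 = 1 \<or> \<sigma>2 = - 1" "0 < \<mu>2"
    "\<And>w. w \<in> graph_plane A2 \<Longrightarrow> \<mu>2 * norm (rot_form C w) \<le> \<sigma>2 * Im (rot_form C w)"
    "\<And>w. w \<in> graph_plane A2 \<Longrightarrow> rot_form C w = 0 \<Longrightarrow> w = 0"
    using rot_form_graph_plane_sector[OF sym(1) det(2) sym(3)] by blast
  \<comment> \<open>The sign is normalised so that \<open>P2\<close> always maps into the lower
    cone.\<close>
  define q where "q = (\<lambda>z. of_real (- \<sigma>2) * rot_form C (g z))"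
  have q: "q \<in> hpoly"
    unfolding q_def rot_form_def
    by (intro hpoly_intros clinear_iso_coordinates_hpoly[OF assms(9)])
  have g0: "g 0 = 0"
    by (rule clinear_iso_zero[OF assms(9)])
  have zero_iff: "z = 0" if "g z = 0" for z
    using that g0 clinear_iso_inj[OF assms(9), of z 0] by simp
  have zero: "0 \<in> P0" "0 \<in> P1" "0 \<in> P2"
    using assms(1-3) by (auto simp: real_plane_def subspace_0)
  have nq: "norm (q z) = norm (rot_form C (g z))" and imq: "Im (q z) = - \<sigma>2 * Im (rot_form C (g z))" for z
    using 2(1) by (auto simp: q_def norm_mult)
  have q0: "q 0 = 0"
    by (simp add: q_def g0 rot_form_def)
  have P0: "Im (q z) = 0" if "z \<in> P0" for z
    using rot_form_R2[of "g z" C] assms(10) that by (auto simp: imq)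
  have g1: "g z \<in> graph_plane A1" if "z \<in> P1" for z
    using assms(11) that by blast
  have g2: "g z \<in> graph_plane A2" if "z \<in> P2" for z
    using assms(12) that by blast
  have zeros: "z \<in> P0" if "z \<in> P0 \<union> P1 \<union> P2" "q z = 0" for z
  proof -
    have "rot_form C (g z) = 0"
      using that(2) nq by (metis norm_eq_zero)
    then show ?thesis
      using that(1) g1 g2 1(4) 2(4) zero_iff zero by blast
  qed
  define c where "c = min \<mu>1 \<mu>2"
  have c: "0 < c"
    using 1(2) 2(2) by (simp add: c_def)
  have P2: "Im (q z) \<le> - c * norm (q z)" if "z \<in> P2" for z
  proof -
    have "c * norm (q z) \<le> \<mu>2 * norm (q z)"
      by (intro mult_right_mono) (auto simp: c_def)
    then show ?thesis
      using 2(3)[OF g2[OF that]] by (simp add: imq nq)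
  qed
  \<comment> \<open>Zeros of q on the three planes lie in \<open>P0\<close>, so the zero fibre is a
    compact subset of a copy of R^2.\<close>
  have fibre: "poly_convex {z \<in> X. q z = 0} \<and> {z \<in> X. q z = 0} \<noteq> {}"
    if "compact X" "X \<subseteq> P0 \<union> P1 \<union> P2" "0 \<in> X" for X
  proof -
    have "{z \<in> X. q z = 0} \<noteq> {}"
      using that(3) q0 by blast
    moreover have "{z \<in> X. q z = 0} \<subseteq> P0"
      using that(2) zeros by blast
    ultimately show ?thesis
      using poly_convex_subset_R2[OF assms(9,10) compact_hpoly_zeros[OF that(1) q]] by blast
  qed
  note cpt = compact_plane_ball[OF assms(1)] compact_plane_ball[OF assms(2)] compact_plane_ball[OF assms(3)]
  show ?thesis
  proof (cases "\<sigma>1 = \<sigma>2")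
    case True
    have P1: "Im (q z) \<le> - c * norm (q z)" if "z \<in> P1" for z
    proof -
      have "c * norm (q z) \<le> \<mu>1 * norm (q z)"
        by (intro mult_right_mono) (auto simp: c_def)
      then show ?thesis
        using 1(3)[OF g1[OF that]] True by (simp add: imq nq)
    qed
    \<comment> \<open>Both planes in the cone form one piece, and its local convexity fixes the
      radius; the slice of the single plane \<open>P0\<close> is convex for every radius.\<close>
    obtain r where r: "0 < r" "poly_convex ((P1 \<union> P2) \<inter> cball 0 r)"
      using assms(15) unfolding loc_poly_convex_at_def by blast
    have ne: "0 \<in> P0 \<inter> cball 0 r" "0 \<in> (P1 \<union> P2) \<inter> cball 0 r"
      using zero r(1) by auto
    have cpt12: "compact ((P1 \<union> P2) \<inter> cball 0 r)"
      using cpt by (simp add: Int_Un_distrib2 compact_Un)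
    have "poly_convex (P0 \<inter> cball 0 r)"
      using ne(1) by (intro poly_convex_subset_R2[OF assms(9,10) cpt(1)]) auto
    moreover have "poly_convex {z \<in> P0 \<inter> cball 0 r \<union> (P1 \<union> P2) \<inter> cball 0 r. q z = 0} \<and>
        {z \<in> P0 \<inter> cball 0 r \<union> (P1 \<union> P2) \<inter> cball 0 r. q z = 0} \<noteq> {}"
      using ne by (intro fibre compact_Un cpt cpt12) auto
    ultimately have "poly_convex (P0 \<inter> cball 0 r \<union> (P1 \<union> P2) \<inter> cball 0 r)"
      using ne r(2) P0 P1 P2 cpt(1) cpt12
      by (intro poly_convex_union_sector[OF _ _ _ _ _ _ _ _ q c]) auto
    moreover have "P0 \<inter> cball 0 r \<union> (P1 \<union> P2) \<inter> cball 0 r = (P0 \<union> P1 \<union> P2) \<inter> cball 0 r"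
      by blast
    ultimately show ?thesis
      using r(1) unfolding loc_poly_convex_at_def by auto
  next
    case False
    then have s: "- \<sigma>2 = \<sigma>1"
      using 1(1) 2(1) by auto
    have P1: "0 \<le> Im (q z)" if "z \<in> P1" for z
    proof -
      have "0 \<le> \<mu>1 * norm (rot_form C (g z))"
        using 1(2) by simp
      also have "\<dots> \<le> Im (q z)"
        unfolding imq s by (rule 1(3)[OF g1[OF that]])
      finally show ?thesis .
    qed
    \<comment> \<open>Here \<open>P0\<close> and \<open>P1\<close> share the upper half-plane, so
      their union fixes the radius and \<open>P2\<close> is the single plane.\<close>
    obtain r where r: "0 < r" "poly_convex ((P0 \<union> P1) \<inter> cball 0 r)"
      using assms(13) unfolding loc_poly_convex_at_def by blast
    have ne: "0 \<in> (P0 \<union> P1) \<inter> cball 0 r" "0 \<in> P2 \<inter> cball 0 r"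
      using zero r(1) by auto
    have cpt01: "compact ((P0 \<union> P1) \<inter> cball 0 r)"
      using cpt by (simp add: Int_Un_distrib2 compact_Un)
    have "poly_convex (P2 \<inter> cball 0 r)"
      using ne(2) by (intro poly_convex_subset_graph_plane[OF assms(9,12,6) cpt(3)]) auto
    moreover have "poly_convex {z \<in> (P0 \<union> P1) \<inter> cball 0 r \<union> P2 \<inter> cball 0 r. q z = 0} \<and>
        {z \<in> (P0 \<union> P1) \<inter> cball 0 r \<union> P2 \<inter> cball 0 r. q z = 0} \<noteq> {}"
      using ne by (intro fibre compact_Un cpt cpt01) auto
    ultimately have "poly_convex ((P0 \<union> P1) \<inter> cball 0 r \<union> P2 \<inter> cball 0 r)"
      using ne r(2) P0 P1 P2 cpt(3) cpt01
      by (intro poly_convex_union_sector[OF _ _ _ _ _ _ _ _ q c]) auto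
    moreover have "(P0 \<union> P1) \<inter> cball 0 r \<union> P2 \<inter> cball 0 r = (P0 \<union> P1 \<union> P2) \<inter> cball 0 r"
      by blast
    ultimately show ?thesis
      using r(1) unfolding loc_poly_convex_at_def by auto
  qed
qed

end
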